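(* Let $f:[0,1]\to(0,1)$ be a $C^3$ function whose fixed points are isolated, and assume $f\ge 1/2$ on $[0,1]$. Let $w_0=(\alpha_0^x,l_0^x)_{x\in\mathbb{Z}}\in([0,1]\times(0,+\infty))^{\mathbb{Z}}$ be an initial environment such that $w_0^x=w_0^1$ for all $x\ge 1$. Let $X$ be the generalized reinforced random walk associated to $f$ with law $\mathbb{P}_{0,w_0}$. Then $X$ is almost surely recurrent if and only if $\mathbb{E}[\delta^1_\infty]\le 1$.
   Context: Urn process associated to $f$: a Markov chain $((\alpha_n,l_n),n\ge 0)$ on $[0,1]\times(0,+\infty)$ with $l_{n+1}=l_n+1$, and $\alpha_{n+1}=(l_n\alpha_n+1)/(l_n+1)$ with probability $f(\alpha_n)$, $\alpha_{n+1}=l_n\alpha_n/(l_n+1)$ with probability $1-f(\alpha_n)$. Generalized reinforced random walk started at $(0,w_0)$ associated to $f$: $X_0=0$; for $x\in\mathbb{Z}$, $n\ge0$ let $L_n^x=\sum_{k=0}^{n-1}1_{\{X_k=x\}}$ and $\tilde\alpha_n^x=\frac{1}{l_0^x+L_n^x}\big(\alpha_0^xl_0^x+\sum_{k=0}^{n-1}1_{\{X_k=x,X_{k+1}=x+1\}}\big)$; given the past, if $X_n=x$ then $X_{n+1}=x+1$ with probability $f(\tilde\alpha_n^x)$ and $X_{n+1}=x-1$ otherwise. Its law is denoted $\mathbb{P}_{0,w_0}$ (and $\mathbb{P}_{k,w_0}$ when started at $k$). The walk is recurrent if it visits every site infinitely often. $\delta^1_\infty:=\sum_{k\ge 0}(2f(\alpha_k)-1)$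 where $(\alpha_k,l_k)_{k\ge0}$ is an urn process associated to $f$ started from $(\alpha_0,l_0)=w_0^1$; $\mathbb{E}$ denotes expectation for this urn process. *)

theory Defs
  imports "HOL-Probability.Probability"
begin

text \<open>Randomness source: an i.i.d. sequence of uniform [0,1] variables.
  Both processes are realised by the standard coupling: step "up" at time n
  iff U n < (probability of going up).\<close>

definition unif_seq :: "(nat \<Rightarrow> real) measure" where
  "unif_seq = PiM UNIV (\<lambda>_. uniform_measure lborel {0..1::real})"

definition C3_on_unit :: "(real \<Rightarrow> real) \<Rightarrow> bool" where
  "C3_on_unit f \<longleftrightarrow> (\<exists>f1 f2 f3.
      (\<forall>x\<in>{0..1}. (f has_real_derivative f1 x) (at x within {0..1})) \<and>
      (\<forall>x\<in>{0..1}. (f1 has_real_derivative f2 x) (at x within {0..1})) \<and>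
      (\<forall>x\<in>{0..1}. (f2 has_real_derivative f3 x) (at x within {0..1})) \<and>
      continuous_on {0..1} f3)"

definition isolated_fixed_points :: "(real \<Rightarrow> real) \<Rightarrow> bool" where
  "isolated_fixed_points f \<longleftrightarrow> (\<forall>x\<in>{0..1}. f x = x \<longrightarrow>
      (\<exists>e>0. \<forall>y\<in>{0..1}. f y = y \<and> \<bar>y - x\<bar> < e \<longrightarrow> y = x))"

primrec urn_alpha :: "(real \<Rightarrow> real) \<Rightarrow> real \<Rightarrow> real \<Rightarrow> (nat \<Rightarrow> real) \<Rightarrow> nat \<Rightarrow> real" where
  "urn_alpha f a0 l0 U 0 = a0"
| "urn_alpha f a0 l0 U (Suc k) =
     (let a = urn_alpha f a0 l0 U k; l = l0 + real k in
      if U k < f a then (l * a + 1) / (l + 1) else l * a / (l + 1))"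

text \<open>Reinforced environment at site x given the path xs = [X_0,...,X_n]
  (n = length xs - 1).\<close>
definition env_alpha :: "(int \<Rightarrow> real) \<Rightarrow> (int \<Rightarrow> real) \<Rightarrow> int list \<Rightarrow> int \<Rightarrow> real" where
  "env_alpha a0 l0 xs x =
     (let n = length xs - 1;
          L = card {k. k < n \<and> xs ! k = x};
          U = card {k. k < n \<and> xs ! k = x \<and> xs ! Suc k = x + 1}
      in (a0 x * l0 x + real U) / (l0 x + real L))"

primrec grrw_path :: "(real \<Rightarrow> real) \<Rightarrow> (int \<Rightarrow> real) \<Rightarrow> (int \<Rightarrow> real) \<Rightarrow> (nat \<Rightarrow> real) \<Rightarrow> nat \<Rightarrow> int list" where
  "grrw_path f a0 l0 U 0 = [0]"
| "grrw_path f a0 l0 U (Suc n) =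
     (let xs = grrw_path f a0 l0 U n; x = last xs in
      xs @ [if U n < f (env_alpha a0 l0 xs x) then x + 1 else x - 1])"

definition grrw :: "(real \<Rightarrow> real) \<Rightarrow> (int \<Rightarrow> real) \<Rightarrow> (int \<Rightarrow> real) \<Rightarrow> (nat \<Rightarrow> real) \<Rightarrow> nat \<Rightarrow> int" where
  "grrw f a0 l0 U n = last (grrw_path f a0 l0 U n)"

definition recurrent_path :: "(nat \<Rightarrow> int) \<Rightarrow> bool" where
  "recurrent_path X \<longleftrightarrow> (\<forall>x::int. infinite {n. X n = x})"

end

theory Submission
  imports Defs "HOL-Real_Asymp.Real_Asymp"
begin

text \<open>
  Give every site its own independent urn, read as a stack of arrows; the walk that follows the
  arrows has the law of the reinforced walk. Let \<open>T\<^sub>k\<close> be the first hitting time of \<open>k\<close>. The number of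
  steps from \<open>x + 1\<close> to \<open>x\<close> before \<open>T\<^sub>k\<close> is a function of the stacks strictly between \<open>x\<close> and \<open>k\<close>
  only, and its law depends on \<open>k - x\<close> only. On the other hand the walk minus its accumulated drift
  is a martingale.

  If the walk is recurrent, then stopping at \<open>T\<^sub>k\<close> bounds the expected drift consumed at the sites
  \<open>1, \<dots>, k - 1\<close> by \<open>k\<close>, whereas most of these sites are visited more than \<open>N\<close> times before \<open>T\<^sub>k\<close>;
  averaging over the sites shows that the mean drift of the first \<open>N\<close> arrows of a stack is at most 1.

  If the walk is not recurrent, then with probability \<open>p > 0\<close> a walk arriving at a fresh half-line
  never leaves it. Stop a first step to 1 followed by an excursion at the first visit to 0 or \<open>k\<close>,
  and let \<open>b\<^sub>k\<close> be the probability of reaching \<open>k\<close>. The martingale gives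
  \<open>k b\<^sub>k \<le> 1 + (g - h p) (b\<^sub>1 + \<dots> + b\<^sub>k\<^sub>-\<^sub>1)\<close>, where \<open>g\<close> is the mean total drift of a stack and \<open>h\<close> the
  mean drift left in a stack whose first arrow is up after that arrow has been used. Since \<open>b\<^sub>k\<close>
  decreases to a positive limit, \<open>g - h p \<ge> 1\<close>. Moreover \<open>h > 0\<close> unless \<open>g = 0\<close>, because the
  compositions an urn can reach after a first up arrow are dense, so \<open>g > 1\<close>.
\<close>

section \<open>Independent uniform variables\<close>

text \<open>The index type is left free: the given walk reads one variable per time, whereas the
  stacks are indexed by a site and a height.\<close>

definition iid_unif :: "('i \<Rightarrow> real) measure" where
  "iid_unif = PiM UNIV (\<lambda>_. uniform_measure lborel {0..1::real})"

lemma unif_seq_eq_iid_unif: "unif_seq = iid_unif"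
  by (simp add: unif_seq_def iid_unif_def)

lemma prob_space_unif01: "prob_space (uniform_measure lborel {0..1::real})"
  by (rule prob_space_uniform_measure) auto

lemma prob_space_iid_unif: "prob_space iid_unif"
  unfolding iid_unif_def by (intro prob_space_PiM prob_space_unif01)

interpretation iid_unif: prob_space "iid_unif :: ('i \<Rightarrow> real) measure"
  by (rule prob_space_iid_unif)

lemma space_iid_unif [simp]: "space iid_unif = UNIV"
  by (simp add: iid_unif_def space_PiM)

lemma measure_iid_unif_UNIV [simp]: "measure iid_unif UNIV = 1"
  using iid_unif.prob_space by simp

lemma measurable_iid_unif_component [measurable]: "(\<lambda>V. V i) \<in> borel_measurable iid_unif"
proof -
  have "(\<lambda>V. V i) \<in> measurable (PiM UNIV (\<lambda>_. uniform_measure lborel {0..1::real})) (uniform_measure lborel {0..1::real})"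
    by (rule measurable_component_singleton) auto
  moreover have "measurable (PiM UNIV (\<lambda>_. uniform_measure lborel {0..1::real})) (uniform_measure lborel {0..1::real}) =
      measurable (PiM UNIV (\<lambda>_. uniform_measure lborel {0..1::real})) borel"
    by (intro measurable_cong_sets) auto
  ultimately show ?thesis by (simp add: iid_unif_def)
qed

lemma iid_unif_sets_Collect: "Measurable.pred iid_unif P \<Longrightarrow> {V. P V} \<in> sets iid_unif"
  by (simp add: pred_def)

lemma measurable_into_iid_unif:
  assumes "\<And>i. (\<lambda>x. g x i) \<in> borel_measurable M"
  shows "g \<in> measurable M iid_unif"
proof -
  have "measurable M (uniform_measure lborel {0..1::real}) = borel_measurable M"
    by (intro measurable_cong_sets) auto
  then show ?thesis
    using assms unfolding iid_unif_def by (intro measurable_PiM_single') (auto simp: space_PiM)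
qed

lemma distr_iid_unif_reindex:
  assumes "inj h"
  shows "distr iid_unif iid_unif (\<lambda>V i. V (h i)) = iid_unif"
  using distr_PiM_reindex[of UNIV "\<lambda>_. uniform_measure lborel {0..1::real}" h UNIV] assms
  by (simp add: iid_unif_def prob_space_unif01 restrict_def)

lemma nn_integral_iid_unif_reindex:
  assumes "inj h" and [measurable]: "F \<in> borel_measurable iid_unif"
  shows "(\<integral>\<^sup>+V. F (\<lambda>i. V (h i)) \<partial>iid_unif) = (\<integral>\<^sup>+V. F V \<partial>iid_unif)"
proof -
  have [measurable]: "(\<lambda>V i. V (h i)) \<in> measurable iid_unif iid_unif"
    by (rule measurable_into_iid_unif) simp
  show ?thesis
    using nn_integral_distr[of "\<lambda>V i. V (h i)" iid_unif iid_unif F]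
    by (simp add: distr_iid_unif_reindex[OF \<open>inj h\<close>])
qed

lemma measure_iid_unif_reindex:
  assumes "inj h" and [measurable]: "Measurable.pred iid_unif P"
  shows "measure iid_unif {V. P (\<lambda>i. V (h i))} = measure iid_unif {V. P V}"
proof -
  have [measurable]: "(\<lambda>V i. V (h i)) \<in> measurable iid_unif iid_unif"
    by (rule measurable_into_iid_unif) simp
  have "{V. P V} \<in> sets iid_unif"
    using assms(2) by (simp add: pred_def)
  then show ?thesis
    using measure_distr[of "\<lambda>V i. V (h i)" iid_unif iid_unif "{V. P V}"]
    by (simp add: distr_iid_unif_reindex[OF \<open>inj h\<close>] vimage_def)
qed

section \<open>Box probabilities and independence of disjoint blocks of variables\<close>

lemma emeasure_unif01_lessThan:
  assumes "0 \<le> c" "c \<le> 1"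
  shows "emeasure (uniform_measure lborel {0..1::real}) {u. (u < c) = b} = ennreal (if b then c else 1 - c)"
proof -
  have "{0..1} \<inter> {..<c} = {0..<c}" "{0..1} \<inter> {c..} = {c..1}"
    using assms by auto
  moreover have "{u. (u < c) = b} = (if b then {..<c} else {c..})"
    by auto
  ultimately show ?thesis
    using assms by (simp add: divide_ennreal_def)
qed

text \<open>The indices \<open>h k\<close> are distinct, so the event is a finite-dimensional box of
  the product measure. They stay arbitrary because a path determines which variables its steps
  consult.\<close>

lemma measure_iid_unif_box:
  fixes n :: nat
  assumes "inj_on h {..<n}" and c: "\<And>k. k < n \<Longrightarrow> 0 \<le> c k \<and> c k \<le> 1"
  shows "measure iid_unif {V. \<forall>k<n. (V (h k) < c k) = b k} = (\<Prod>k<n. if b k then c k else 1 - c k)"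
proof -
  interpret product_prob_space "\<lambda>_::'i. uniform_measure lborel {0..1::real}" UNIV
    by (intro product_prob_spaceI prob_space_unif01)
  define X where "X i = {u. (u < c (the_inv_into {..<n} h i)) = b (the_inv_into {..<n} h i)}" for i
  have inv [simp]: "the_inv_into {..<n} h (h k) = k" if "k < n" for k
    using assms that by (intro the_inv_into_f_f) auto
  have X: "X i \<in> sets borel" for i
    unfolding X_def by measurable
  have "{V. \<forall>k<n. (V (h k) < c k) = b k} =
      prod_emb UNIV (\<lambda>_. uniform_measure lborel {0..1::real}) (h ` {..<n}) (Pi\<^sub>E (h ` {..<n}) X)"
    by (auto simp: prod_emb_def X_def PiE_iff)
  also have "emeasure iid_unif \<dots> = (\<Prod>i\<in>h ` {..<n}. emeasure (uniform_measure lborel {0..1::real}) (X i))"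
    unfolding iid_unif_def using X by (subst emeasure_PiM_emb) auto
  also have "\<dots> = (\<Prod>k<n. emeasure (uniform_measure lborel {0..1::real}) (X (h k)))"
    using assms by (simp add: prod.reindex)
  also have "\<dots> = (\<Prod>k<n. ennreal (if b k then c k else 1 - c k))"
  proof (rule prod.cong)
    fix k assume "k \<in> {..<n}"
    then show "emeasure (uniform_measure lborel {0..1::real}) (X (h k)) = ennreal (if b k then c k else 1 - c k)"
      using emeasure_unif01_lessThan[of "c k" "b k"] c by (simp add: X_def)
  qed simp
  also have "\<dots> = ennreal (\<Prod>k<n. if b k then c k else 1 - c k)"
    using c by (intro prod_ennreal) auto
  finally show ?thesis
    using c by (auto simp: measure_def intro!: enn2real_ennreal prod_nonneg)
qed

text \<open>Functions of two disjoint blocks of independent variables are independent. Dependence on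
  a block is expressed by invariance under changes outside it, the form in which the congruence
  rules for urns and \<open>cross_count\<close> provide it.\<close>

lemma nn_integral_iid_unif_indep:
  fixes F G :: "('i \<Rightarrow> real) \<Rightarrow> ennreal"
  assumes F [measurable]: "F \<in> borel_measurable iid_unif" and G [measurable]: "G \<in> borel_measurable iid_unif"
    and FJ: "\<And>V W. (\<And>i. i \<in> J \<Longrightarrow> V i = W i) \<Longrightarrow> F V = F W"
    and GK: "\<And>V W. (\<And>i. i \<in> K \<Longrightarrow> V i = W i) \<Longrightarrow> G V = G W"
    and "J \<inter> K = {}"
  shows "(\<integral>\<^sup>+V. F V * G V \<partial>iid_unif) = (\<integral>\<^sup>+V. F V \<partial>iid_unif) * (\<integral>\<^sup>+V. G V \<partial>iid_unif)"
proof -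
  let ?u = "uniform_measure lborel {0..1::real}"
  have comp: "(\<lambda>V. V i) \<in> measurable iid_unif ?u" for i :: 'i
    unfolding iid_unif_def by (rule measurable_component_singleton) auto
  have "iid_unif.indep_vars (\<lambda>_. ?u) (\<lambda>i V. V i) (UNIV :: 'i set)"
  proof (subst iid_unif.indep_vars_iff_distr_eq_PiM')
    have "distr iid_unif ?u (\<lambda>V. V i) = ?u" for i :: 'i
      unfolding iid_unif_def by (rule distr_PiM_component) (auto intro: prob_space_unif01)
    then show "distr iid_unif (Pi\<^sub>M UNIV (\<lambda>i. ?u)) (\<lambda>x. \<lambda>i\<in>UNIV. x i) =
      Pi\<^sub>M UNIV (\<lambda>i::'i. distr iid_unif ?u (\<lambda>V. V i))"
      using distr_iid_unif_reindex[of "\<lambda>i::'i. i"] by (simp add: iid_unif_def restrict_def)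
  qed (auto simp: comp)
  then have ind: "iid_unif.indep_vars (\<lambda>j. PiM (if j then J else K) (\<lambda>_. ?u))
      (\<lambda>j V. restrict (\<lambda>i. V i) (if j then J else K)) (UNIV :: bool set)"
    using \<open>J \<inter> K = {}\<close>
    by (intro iid_unif.indep_vars_restrict) (auto simp: disjoint_family_on_def)
  \<comment> \<open>\<open>e I\<close> refills the coordinates outside \<open>I\<close> with 0, so
    that \<open>F\<close> and \<open>G\<close> become measurable functions on the products over
    \<open>J\<close> and \<open>K\<close> alone.\<close>
  define e :: "'i set \<Rightarrow> ('i \<Rightarrow> real) \<Rightarrow> 'i \<Rightarrow> real" where "e I V i = (if i \<in> I then V i else 0)" for I V i
  have e: "e I \<in> measurable (PiM I (\<lambda>_. ?u)) iid_unif" for I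
  proof (rule measurable_into_iid_unif)
    fix i
    have "(\<lambda>x. x i) \<in> borel_measurable (Pi\<^sub>M I (\<lambda>_. ?u))" if "i \<in> I"
      using measurable_component_singleton[OF that, of "\<lambda>_. ?u"]
        measurable_cong_sets[of "Pi\<^sub>M I (\<lambda>_. ?u)" "Pi\<^sub>M I (\<lambda>_. ?u)" ?u borel] by auto
    then show "(\<lambda>x. e I x i) \<in> borel_measurable (Pi\<^sub>M I (\<lambda>_. ?u))"
      by (cases "i \<in> I") (auto simp: e_def)
  qed
  have "iid_unif.indep_vars (\<lambda>_. borel) (\<lambda>j V. (if j then F else G) (e (if j then J else K) (restrict V (if j then J else K)))) UNIV"
  proof (rule iid_unif.indep_vars_compose2[OF ind])
    fix j :: bool
    show "(\<lambda>V. (if j then F else G) (e (if j then J else K) V)) \<in> borel_measurable (Pi\<^sub>M (if j then J else K) (\<lambda>_. ?u))"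
      using measurable_compose[OF e F] measurable_compose[OF e G] by (cases j) auto
  qed
  moreover have "F (e J (restrict V J)) = F V" for V
    by (rule FJ) (simp add: e_def)
  moreover have "G (e K (restrict V K)) = G V" for V
    by (rule GK) (simp add: e_def)
  ultimately show ?thesis
    using iid_unif.indep_vars_nn_integral[of UNIV "\<lambda>j V. (if j then F else G) (e (if j then J else K) (restrict V (if j then J else K)))"]
    by (simp add: UNIV_bool mult.commute)
qed

lemma AE_iid_unif_ex_ge:
  fixes h :: "nat \<Rightarrow> 'i"
  assumes "inj h" "0 \<le> c" "c < 1"
  shows "AE V in iid_unif. \<exists>k. \<not> V (h k) < c"
proof -
  have [measurable]: "{V. \<forall>k. V (h k) < c} \<in> sets iid_unif"
    by (rule iid_unif_sets_Collect) measurable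
  have "measure iid_unif {V. \<forall>k. V (h k) < c} \<le> c ^ n" for n
  proof -
    have "measure iid_unif {V. \<forall>k<n. (V (h k) < c) = True} = c ^ n"
      using assms by (subst measure_iid_unif_box) (auto intro: inj_on_subset)
    moreover have "{V. \<forall>k<n. (V (h k) < c) = True} \<in> sets iid_unif"
    by (rule iid_unif_sets_Collect) measurable
    ultimately show ?thesis
      using iid_unif.finite_measure_mono[of "{V. \<forall>k. V (h k) < c}" "{V. \<forall>k<n. (V (h k) < c) = True}"] by auto
  qed
  moreover have "(\<lambda>n. c ^ n) \<longlonglongrightarrow> 0"
    using assms by (intro LIMSEQ_realpow_zero) auto
  ultimately have "measure iid_unif {V. \<forall>k. V (h k) < c} \<le> 0"
    by (intro LIMSEQ_le_const[of "\<lambda>n. c ^ n"]) auto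
  then have "emeasure iid_unif {V. \<forall>k. V (h k) < c} = 0"
    by (simp add: iid_unif.emeasure_eq_measure measure_le_0_iff)
  then show ?thesis
    by (intro AE_I[of _ _ "{V. \<forall>k. V (h k) < c}"]) auto
qed

lemma AE_iid_unif_ex_less:
  fixes h :: "nat \<Rightarrow> 'i"
  assumes "inj h" "0 < c" "c \<le> 1"
  shows "AE V in iid_unif. \<exists>k. V (h k) < c"
proof -
  have [measurable]: "{V. \<forall>k. \<not> V (h k) < c} \<in> sets iid_unif"
    by (rule iid_unif_sets_Collect) measurable
  have "measure iid_unif {V. \<forall>k. \<not> V (h k) < c} \<le> (1 - c) ^ n" for n
  proof -
    have "measure iid_unif {V. \<forall>k<n. (V (h k) < c) = False} = (1 - c) ^ n"
      using assms by (subst measure_iid_unif_box) (auto intro: inj_on_subset)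
    moreover have "{V. \<forall>k<n. (V (h k) < c) = False} \<in> sets iid_unif"
    by (rule iid_unif_sets_Collect) measurable
    ultimately show ?thesis
      using iid_unif.finite_measure_mono[of "{V. \<forall>k. \<not> V (h k) < c}" "{V. \<forall>k<n. (V (h k) < c) = False}"] by auto
  qed
  moreover have "(\<lambda>n. (1 - c) ^ n) \<longlonglongrightarrow> 0"
    using assms by (intro LIMSEQ_realpow_zero) auto
  ultimately have "measure iid_unif {V. \<forall>k. \<not> V (h k) < c} \<le> 0"
    by (intro LIMSEQ_le_const[of "\<lambda>n. (1 - c) ^ n"]) auto
  then have "emeasure iid_unif {V. \<forall>k. \<not> V (h k) < c} = 0"
    by (simp add: iid_unif.emeasure_eq_measure measure_le_0_iff)
  then show ?thesis
    by (intro AE_I[of _ _ "{V. \<forall>k. \<not> V (h k) < c}"]) auto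
qed

section \<open>Walks driven by arrow stacks\<close>

text \<open>
  The number of down arrows above the \<open>m + 1\<close>st up arrow of the stack \<open>s\<close>; it is only meaningful if
  such an up arrow exists, since \<open>card\<close> of an infinite set is 0.
\<close>

definition downs_before_up :: "(nat \<Rightarrow> bool) \<Rightarrow> nat \<Rightarrow> nat" where
  "downs_before_up s m = card {j. \<not> s j \<and> card {i. i < j \<and> s i} \<le> m}"

text \<open>
  \<open>cross_count A j x\<close> is the number of steps from \<open>x + 1\<close> to \<open>x\<close> made before \<open>x + 1 + j\<close> is first hit:
  at that time \<open>x + 1\<close> has been left upwards once more often than the edge above it has been
  crossed downwards, the last time upwards.
\<close>

primrec cross_count :: "(int \<Rightarrow> nat \<Rightarrow> bool) \<Rightarrow> nat \<Rightarrow> int \<Rightarrow> nat" where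
  "cross_count A 0 x = 0"
| "cross_count A (Suc j) x = downs_before_up (A (x + 1)) (cross_count A j (x + 1))"

lemma downs_before_up_eq_0:
  assumes "\<And>i. i \<le> m \<Longrightarrow> s i"
  shows "downs_before_up s m = 0"
proof -
  have False if "\<not> s j" "card {i. i < j \<and> s i} \<le> m" for j
  proof -
    have "m < j"
      using assms that by (meson not_le)
    then have "{..m} \<subseteq> {i. i < j \<and> s i}"
      using assms by auto
    then have "card {..m} \<le> card {i. i < j \<and> s i}"
      by (intro card_mono) auto
    then show False
      using that by simp
  qed
  then have "{j. \<not> s j \<and> card {i. i < j \<and> s i} \<le> m} = {}"
    by blast
  then show ?thesis
    unfolding downs_before_up_def by (metis card.empty)
qed

text \<open>This locality is the source of independence: with independent stacks, the count at the
  edge above \<open>x\<close> is independent of the stacks at \<open>x\<close> and to its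
  left.\<close>

lemma cross_count_cong:
  assumes "\<And>z. x < z \<Longrightarrow> z \<le> x + int j \<Longrightarrow> A z = A' z"
  shows "cross_count A j x = cross_count A' j x"
  using assms
proof (induction j arbitrary: x)
  case (Suc j)
  have "cross_count A j (x + 1) = cross_count A' j (x + 1)"
    using Suc.prems by (intro Suc.IH) auto
  moreover have "A (x + 1) = A' (x + 1)"
    using Suc.prems by auto
  ultimately show ?case by simp
qed simp

lemma cross_count_shift: "cross_count (\<lambda>z. A (z + c)) j x = cross_count A j (x + c)"
  by (induction j arbitrary: x) (simp_all add: algebra_simps)

definition visits_before :: "(nat \<Rightarrow> int) \<Rightarrow> nat \<Rightarrow> int \<Rightarrow> nat" where
  "visits_before X n x = card {k. k < n \<and> X k = x}"

definition ups_before :: "(nat \<Rightarrow> int) \<Rightarrow> nat \<Rightarrow> int \<Rightarrow> nat" where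
  "ups_before X n x = card {k. k < n \<and> X k = x \<and> X (Suc k) = x + 1}"

definition downs_before :: "(nat \<Rightarrow> int) \<Rightarrow> nat \<Rightarrow> int \<Rightarrow> nat" where
  "downs_before X n x = card {k. k < n \<and> X k = x \<and> X (Suc k) = x - 1}"

definition first_hit :: "(nat \<Rightarrow> int) \<Rightarrow> nat \<Rightarrow> int \<Rightarrow> bool" where
  "first_hit X n k \<longleftrightarrow> X n = k \<and> (\<forall>m<n. X m \<noteq> k)"

lemma card_less_Suc_Collect:
  "card {k. k < Suc n \<and> P k} = card {k. k < n \<and> P k} + (if P n then 1 else 0)"
proof -
  have "{k. k < Suc n \<and> P k} = (if P n then insert n {k. k < n \<and> P k} else {k. k < n \<and> P k})"
    by (auto simp: less_Suc_eq)
  then show ?thesis by simp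
qed

lemma card_less_Collect_mono: "m \<le> n \<Longrightarrow> card {k. k < m \<and> P k} \<le> card {k. k < (n::nat) \<and> P k}"
  by (intro card_mono) auto

lemma infinite_iff_card_unbounded:
  "infinite {k::nat. P k} \<longleftrightarrow> (\<forall>N. \<exists>n. N \<le> card {k. k < n \<and> P k})"
proof
  assume inf: "infinite {k. P k}"
  show "\<forall>N. \<exists>n. N \<le> card {k. k < n \<and> P k}"
  proof
    fix N
    obtain B where B: "finite B" "card B = N" "B \<subseteq> {k. P k}"
      using infinite_arbitrarily_large[OF inf] by blast
    obtain n where "\<forall>k\<in>B. k < n"
      using B(1) finite_nat_set_iff_bounded by blast
    then have "B \<subseteq> {k. k < n \<and> P k}"
      using B by auto
    then show "\<exists>n. N \<le> card {k. k < n \<and> P k}"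
      using B(2) card_mono[of "{k. k < n \<and> P k}" B] by auto
  qed
next
  assume unb: "\<forall>N. \<exists>n. N \<le> card {k. k < n \<and> P k}"
  show "infinite {k. P k}"
  proof
    assume fin: "finite {k. P k}"
    obtain n where "Suc (card {k. P k}) \<le> card {k. k < n \<and> P k}"
      using unb by blast
    moreover have "card {k. k < n \<and> P k} \<le> card {k. P k}"
      using fin by (intro card_mono) auto
    ultimately show False by simp
  qed
qed

lemma visits_before_Suc:
  "visits_before X (Suc n) x = visits_before X n x + (if X n = x then 1 else 0)"
  unfolding visits_before_def by (rule card_less_Suc_Collect)

lemma ups_before_Suc:
  "ups_before X (Suc n) x = ups_before X n x + (if X n = x \<and> X (Suc n) = x + 1 then 1 else 0)"
  unfolding ups_before_def by (rule card_less_Suc_Collect)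

lemma downs_before_Suc:
  "downs_before X (Suc n) x = downs_before X n x + (if X n = x \<and> X (Suc n) = x - 1 then 1 else 0)"
  unfolding downs_before_def by (rule card_less_Suc_Collect)

lemma before_0 [simp]:
  "visits_before X 0 x = 0" "ups_before X 0 x = 0" "downs_before X 0 x = 0"
  by (simp_all add: visits_before_def ups_before_def downs_before_def)

lemma downs_before_mono: "m \<le> n \<Longrightarrow> downs_before X m x \<le> downs_before X n x"
  unfolding downs_before_def by (rule card_less_Collect_mono)

text \<open>Successive visits to \<open>x\<close> consume the heights 0, 1, 2, ... of its stack in
  order, so a sum over times spent at \<open>x\<close> is a sum over an initial segment of the
  stack.\<close>

lemma sum_by_visits:
  fixes \<phi> :: "int \<Rightarrow> nat \<Rightarrow> 'a::comm_monoid_add"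
  shows "(\<Sum>j<n. if X j = x then \<phi> (X j) (visits_before X j (X j)) else 0) = (\<Sum>i<visits_before X n x. \<phi> x i)"
  by (induction n) (simp_all add: visits_before_Suc)

section \<open>Deterministic crossing counts of a walk that follows its arrows\<close>

locale stack_walk =
  fixes A :: "int \<Rightarrow> nat \<Rightarrow> bool" and X :: "nat \<Rightarrow> int"
  assumes X_0: "X 0 = 0"
    and X_Suc: "X (Suc n) = X n + (if A (X n) (visits_before X n (X n)) then 1 else - 1)"
begin

lemma ups_before_eq: "ups_before X n x = card {j. j < visits_before X n x \<and> A x j}"
  by (induction n) (auto simp: ups_before_Suc visits_before_Suc card_less_Suc_Collect X_Suc)

lemma downs_before_eq: "downs_before X n x = card {j. j < visits_before X n x \<and> \<not> A x j}"
  by (induction n) (auto simp: downs_before_Suc visits_before_Suc card_less_Suc_Collect X_Suc)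

text \<open>Crossings of the edge between \<open>x\<close> and \<open>x + 1\<close> alternate in
  direction and begin upwards, because the start 0 lies on its left.\<close>

lemma ups_before_balance:
  assumes "0 \<le> x"
  shows "ups_before X n x = downs_before X n (x + 1) + (if x < X n then 1 else 0)"
proof (induction n)
  case 0
  then show ?case using assms by (simp add: X_0)
next
  case (Suc n)
  then show ?case
    by (cases "A (X n) (visits_before X n (X n))")
       (auto simp: ups_before_Suc downs_before_Suc X_Suc split: if_splits)
qed

lemma last_arrow_up:
  assumes "0 \<le> x" "x < X n"
  shows "0 < visits_before X n x \<and> A x (visits_before X n x - 1)"
  using assms(2)
proof (induction n)
  case 0
  then show ?case using assms(1) by (simp add: X_0)
next
  case (Suc n)
  then show ?case
    by (cases "X n = x"; cases "x < X n") (auto simp: visits_before_Suc X_Suc split: if_splits)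
qed

text \<open>When the walk is to the right of \<open>x\<close>, the last arrow used at
  \<open>x\<close> was an up arrow, and by balance it was number \<open>m + 1\<close>, where
  \<open>m\<close> counts the steps back from \<open>x + 1\<close>. The down arrows used are
  therefore those preceding that up arrow.\<close>

lemma downs_before_rec:
  assumes "0 \<le> x" "x < X n"
  shows "downs_before X n x = downs_before_up (A x) (downs_before X n (x + 1))"
proof -
  define L where "L = visits_before X n x"
  define m where "m = downs_before X n (x + 1)"
  have L: "0 < L" "A x (L - 1)"
    using last_arrow_up[OF assms] by (auto simp: L_def)
  have ups: "card {j. j < L \<and> A x j} = Suc m"
    using ups_before_balance[OF assms(1), of n] assms(2) ups_before_eq[of n x] by (simp add: L_def m_def)
  have "card {i. i < j \<and> A x i} \<le> m \<longleftrightarrow> j < L" for j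
  proof
    assume "j < L"
    then have "j \<le> L - 1" by simp
    then have "card {i. i < j \<and> A x i} \<le> card {i. i < L - 1 \<and> A x i}"
      by (rule card_less_Collect_mono)
    moreover have "card {i. i < L - 1 \<and> A x i} = m"
      using card_less_Suc_Collect[of "L - 1" "A x"] L ups by simp
    ultimately show "card {i. i < j \<and> A x i} \<le> m" by simp
  next
    assume *: "card {i. i < j \<and> A x i} \<le> m"
    show "j < L"
    proof (rule ccontr)
      assume "\<not> j < L"
      then have "card {i. i < L \<and> A x i} \<le> card {i. i < j \<and> A x i}"
        by (intro card_less_Collect_mono) simp
      then show False using * ups by simp
    qed
  qed
  then have "downs_before_up (A x) m = card {j. j < L \<and> \<not> A x j}"
    by (auto simp: downs_before_up_def intro!: arg_cong[where f = card])
  then show ?thesis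
    by (simp add: downs_before_eq L_def m_def)
qed

text \<open>Induction on the distance to the target. At distance 0 the site \<open>x + 1\<close> is
  the target itself and has not been left; otherwise the recursion for \<open>downs_before\<close>
  is the one defining \<open>cross_count\<close>.\<close>

lemma downs_before_first_hit:
  assumes "first_hit X n (x + 1 + int j)" "0 \<le> x"
  shows "downs_before X n (x + 1) = cross_count A j x"
  using assms
proof (induction j arbitrary: x)
  case 0
  then have "{k. k < n \<and> X k = x + 1 \<and> X (Suc k) = x + 1 - 1} = {}"
    by (auto simp: first_hit_def)
  then show ?case
    unfolding downs_before_def by (metis card.empty cross_count.simps(1))
next
  case (Suc j)
  have "downs_before X n (x + 1 + 1) = cross_count A j (x + 1)"
    using Suc.prems by (intro Suc.IH) (auto simp: algebra_simps)
  moreover have "x + 1 < X n"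
    using Suc.prems by (simp add: first_hit_def)
  ultimately show ?case
    using downs_before_rec[of "x + 1" n] Suc.prems by simp
qed

text \<open>Steps have size 1, so a walk started at 0 cannot pass a nonnegative level without
  hitting it.\<close>

lemma first_hit_exists:
  assumes "k \<le> X m" "0 \<le> k"
  shows "\<exists>n\<le>m. first_hit X n k"
proof -
  define n where "n = (LEAST n. k \<le> X n)"
  have n: "k \<le> X n" "n \<le> m"
    unfolding n_def using assms by (auto intro: LeastI Least_le)
  have less: "X i < k" if "i < n" for i
    using not_less_Least[of i "\<lambda>n. k \<le> X n"] that by (auto simp: n_def)
  have "X n = k"
  proof (cases n)
    case 0
    then show ?thesis using n assms(2) by (simp add: X_0)
  next
    case (Suc i)
    then show ?thesis using n less[of i] by (simp add: X_Suc split: if_splits)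
  qed
  then show ?thesis
    using less n(2) by (force simp: first_hit_def)
qed

lemma X_1: "X 1 = 1 \<longleftrightarrow> A 0 0"
  using X_Suc[of 0] by (simp add: X_0)

lemma X_le: "X n \<le> int n"
proof (induction n)
  case (Suc n)
  then show ?case by (simp add: X_Suc)
qed (simp add: X_0)

lemma cross_count_eq_0_if_reached:
  assumes "1 \<le> j" "X 1 = 1" and nz: "\<And>i. 1 \<le> i \<Longrightarrow> i \<le> j \<Longrightarrow> X i \<noteq> 0" and "X j = 1 + int m"
  shows "cross_count A m 0 = 0"
proof -
  obtain n where n: "n \<le> j" "first_hit X n (0 + 1 + int m)"
    using first_hit_exists[of "0 + 1 + int m" j] assms(4) by auto
  have "{k. k < n \<and> X k = 1 \<and> X (Suc k) = 1 - 1} = {}"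
    using nz n(1) by auto
  then have "downs_before X n 1 = 0"
    unfolding downs_before_def by (metis card.empty)
  then show ?thesis
    using downs_before_first_hit[OF n(2)] by simp
qed

text \<open>Being positive at time 1, the walk can only become nonpositive through a step from 1 to
  0, and \<open>cross_count A m 0 = 0\<close> excludes such steps before the hit.\<close>

lemma positive_until_first_hit:
  assumes "A 0 0" "cross_count A m 0 = 0" "first_hit X n (1 + int m)" "1 \<le> i" "i \<le> n"
  shows "1 \<le> X i"
  using assms(4,5)
proof (induction i rule: dec_induct)
  case base
  then show ?case using X_1 assms(1) by simp
next
  case (step j)
  have "downs_before X n 1 = 0"
    using downs_before_first_hit[of n 0 m] assms by simp
  then have "{k. k < n \<and> X k = 1 \<and> X (Suc k) = 1 - 1} = {}"
    by (simp add: downs_before_def)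
  then have "\<not> (X j = 1 \<and> X (Suc j) = 0)"
    using step by auto
  moreover have "1 \<le> X j"
    using step by simp
  ultimately show ?case
    using X_Suc[of j] by (cases "A (X j) (visits_before X j (X j))") auto
qed

text \<open>Infinitely many visits use up the whole stack, and with it infinitely many arrows of
  either direction.\<close>

lemma infinite_neighbours:
  assumes full: "infinite {j. A x j}" "infinite {j. \<not> A x j}" and inf: "infinite {n. X n = x}"
  shows "infinite {n. X n = x + 1}" "infinite {n. X n = x - 1}"
proof -
  have vis: "\<exists>n. N \<le> visits_before X n x" for N
    using inf unfolding infinite_iff_card_unbounded visits_before_def by blast
  have "\<exists>n. N \<le> ups_before X n x" for N
  proof -
    obtain j where "N \<le> card {i. i < j \<and> A x i}"
      using full(1) unfolding infinite_iff_card_unbounded by blast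
    moreover obtain n where "j \<le> visits_before X n x"
      using vis by blast
    ultimately show ?thesis
      using card_less_Collect_mono[of j "visits_before X n x" "A x"] ups_before_eq[of n x] by (metis order_trans)
  qed
  then have "infinite {k. X k = x \<and> X (Suc k) = x + 1}"
    unfolding infinite_iff_card_unbounded ups_before_def by blast
  then have "infinite (Suc ` {k. X k = x \<and> X (Suc k) = x + 1})"
    by (simp add: finite_image_iff)
  then show "infinite {n. X n = x + 1}"
    by (rule contrapos_nn) (auto elim!: finite_subset[rotated])
  have "\<exists>n. N \<le> downs_before X n x" for N
  proof -
    obtain j where "N \<le> card {i. i < j \<and> \<not> A x i}"
      using full(2) unfolding infinite_iff_card_unbounded by blast
    moreover obtain n where "j \<le> visits_before X n x"
      using vis by blast
    ultimately show ?thesis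
      using card_less_Collect_mono[of j "visits_before X n x" "\<lambda>i. \<not> A x i"] downs_before_eq[of n x] by (metis order_trans)
  qed
  then have "infinite {k. X k = x \<and> X (Suc k) = x - 1}"
    unfolding infinite_iff_card_unbounded downs_before_def by blast
  then have "infinite (Suc ` {k. X k = x \<and> X (Suc k) = x - 1})"
    by (simp add: finite_image_iff)
  then show "infinite {n. X n = x - 1}"
    by (rule contrapos_nn) (auto elim!: finite_subset[rotated])
qed

end

locale full_stack_walk = stack_walk +
  assumes full_up: "infinite {j. A x j}" and full_down: "infinite {j. \<not> A x j}"
begin

lemma infinite_all_sites:
  assumes "infinite {n. X n = x}"
  shows "infinite {n. X n = y}"
proof -
  have "infinite {n. X n = x + int d} \<and> infinite {n. X n = x - int d}" for d
  proof (induction d)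
    case (Suc d)
    then show ?case
      using infinite_neighbours(1)[of "x + int d", OF full_up full_down]
        infinite_neighbours(2)[of "x - int d", OF full_up full_down]
      by (simp add: algebra_simps)
  qed (use assms in simp)
  from this[of "nat \<bar>y - x\<bar>"] show ?thesis
    by (cases "x \<le> y") (auto simp: algebra_simps)
qed

text \<open>One site visited infinitely often would force all sites, including \<open>k\<close>, to
  be visited. Hence each window from \<open>-m\<close> to \<open>k\<close> is left for good, and
  since \<open>k\<close> cannot be passed the exit is to the left.\<close>

lemma escapes_left:
  assumes "\<And>n. X n \<noteq> k" "0 \<le> k"
  shows "\<exists>n0. \<forall>n\<ge>n0. X n < - int m"
proof -
  have "finite {n. X n = x}" for x
    using infinite_all_sites[of x k] assms(1) by auto
  then have "finite (\<Union>x\<in>{- int m..k}. {n. X n = x})"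
    by auto
  then obtain n0 where n0: "\<forall>n\<in>(\<Union>x\<in>{- int m..k}. {n. X n = x}). n < n0"
    using finite_nat_set_iff_bounded by blast
  have "X n < k" for n
    using first_hit_exists[of k n] assms by (force simp: first_hit_def)
  then have "X n < - int m" if "n \<ge> n0" for n
    using n0 that \<open>X n < k\<close> by (metis (mono_tags, lifting) UN_I atLeastAtMost_iff less_imp_le mem_Collect_eq not_le)
  then show ?thesis by blast
qed

end

section \<open>Walks that hit every level to the right\<close>

locale right_reaching_stack_walk = stack_walk +
  assumes hits: "0 \<le> k \<Longrightarrow> \<exists>n. X n = k"
begin

lemma first_hit_hits: "0 \<le> k \<Longrightarrow> \<exists>n. first_hit X n k"
  using hits first_hit_exists by (metis order_refl)

lemma late_first_hit:
  assumes "\<And>i. i \<le> n \<Longrightarrow> X i < k" "0 \<le> k"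
  shows "\<exists>n'\<ge>n. first_hit X n' k"
  using first_hit_hits[OF assms(2)] assms(1) by (metis first_hit_def less_irrefl nle_le)

text \<open>Level \<open>1 + j\<close> is hit before level \<open>1 + Suc j\<close>, so the two
  counts are numbers of steps from 1 to 0 up to increasing times.\<close>

lemma cross_count_mono: "cross_count A j 0 \<le> cross_count A (Suc j) 0"
proof -
  obtain n where n: "first_hit X n (1 + int (Suc j))"
    using first_hit_hits[of "1 + int (Suc j)"] by auto
  then obtain m where m: "m \<le> n" "first_hit X m (1 + int j)"
    using first_hit_exists[of "1 + int j" n] by (auto simp: first_hit_def)
  show ?thesis
    using downs_before_first_hit[of n 0 "Suc j"] downs_before_first_hit[of m 0 j] n m
      downs_before_mono[OF m(1), of X 1] by simp
qed

lemma downs_before_le_cross_count: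
  assumes "0 \<le> x"
  shows "\<exists>j0. \<forall>j\<ge>j0. downs_before X n (x + 1) \<le> cross_count A j x"
proof (intro exI allI impI)
  \<comment> \<open>By time \<open>n\<close> the walk is at most \<open>n\<close>, so for these
    \<open>j\<close> the level \<open>x + 1 + j\<close> has not been hit by then.\<close>
  fix j assume "n + nat x \<le> j"
  then have "X i < x + 1 + int j" if "i \<le> n" for i
    using X_le[of i] that assms by auto
  then obtain n' where "n \<le> n'" "first_hit X n' (x + 1 + int j)"
    using late_first_hit[of n "x + 1 + int j"] assms by auto
  then show "downs_before X n (x + 1) \<le> cross_count A j x"
    using downs_before_first_hit[of n' x j] downs_before_mono[of n n' X "x + 1"] assms by simp
qed

text \<open>A second stay at \<open>x\<close> would come after an up step. By balance that step must
  have been undone by a step from \<open>x + 1\<close> to \<open>x\<close>, which the vanishing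
  counts exclude.\<close>

lemma visited_at_most_once:
  assumes "0 \<le> x" "\<And>j. cross_count A j x = 0" "A x 0" "X n = x"
  shows "visits_before X n x = 0"
proof (rule ccontr)
  assume "visits_before X n x \<noteq> 0"
  then have "0 \<in> {j. j < visits_before X n x \<and> A x j}"
    using assms by simp
  then have "ups_before X n x \<noteq> 0"
    unfolding ups_before_eq by (subst card_0_eq) (simp, blast)
  moreover obtain j0 where "\<forall>j\<ge>j0. downs_before X n (x + 1) \<le> cross_count A j x"
    using downs_before_le_cross_count[OF assms(1)] by blast
  then have "downs_before X n (x + 1) = 0"
    using assms(2) by auto
  ultimately show False
    using ups_before_balance[OF assms(1), of n] assms(4) by simp
qed

lemma cross_count_bounded:
  assumes "finite {n. X n = 1}"
  shows "cross_count A j 0 \<le> card {n. X n = 1}"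
proof -
  obtain n where n: "first_hit X n (0 + 1 + int j)"
    using first_hit_hits[of "0 + 1 + int j"] by auto
  have "downs_before X n 1 \<le> card {n. X n = 1}"
    unfolding downs_before_def using assms by (intro card_mono) auto
  then show ?thesis
    using downs_before_first_hit[OF n] by simp
qed

text \<open>Infinitely many visits to 1 use infinitely many down arrows of its stack. Each of them
  is a step from 1 to 0 and is eventually counted by \<open>cross_count\<close>.\<close>

lemma cross_count_unbounded:
  assumes "infinite {n. X n = 1}" "infinite {j. \<not> A 1 j}"
  shows "\<exists>j0. \<forall>j\<ge>j0. N \<le> cross_count A j 0"
proof -
  obtain j where "N \<le> card {i. i < j \<and> \<not> A 1 i}"
    using assms(2) unfolding infinite_iff_card_unbounded by blast
  moreover obtain n where "j \<le> visits_before X n 1"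
    using assms(1) unfolding infinite_iff_card_unbounded visits_before_def by blast
  ultimately have "N \<le> downs_before X n 1"
    using card_less_Collect_mono[of j "visits_before X n 1" "\<lambda>i. \<not> A 1 i"] downs_before_eq[of n 1] by (metis order_trans)
  then show ?thesis
    using downs_before_le_cross_count[of 0 n] by fastforce
qed

end

section \<open>Laws of the reinforced walk\<close>

lemma urn_alpha_eq:
  assumes "0 < l"
  shows "urn_alpha f a l U k = (a * l + real (card {j. j < k \<and> U j < f (urn_alpha f a l U j)})) / (l + real k)"
proof (induction k)
  case 0
  then show ?case using assms by simp
next
  case (Suc k)
  have "l + real k > 0" using assms by simp
  then have "(l + real k) * urn_alpha f a l U k = a * l + real (card {j. j < k \<and> U j < f (urn_alpha f a l U j)})"
    by (subst Suc.IH) simp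
  then show ?case
    by (simp add: Let_def card_less_Suc_Collect add_ac)
qed

lemma cesaro_mean_tendsto:
  fixes r :: "nat \<Rightarrow> real"
  assumes "r \<longlonglongrightarrow> L"
  shows "(\<lambda>m. (\<Sum>j<m. r j) / real m) \<longlonglongrightarrow> L"
proof (rule LIMSEQ_I)
  fix e :: real assume e: "0 < e"
  obtain n0 where n0: "\<forall>j\<ge>n0. norm (r j - L) < e/2"
    using LIMSEQ_D[OF assms, of "e/2"] e by auto
  define C where "C = (\<Sum>j<n0. \<bar>r j - L\<bar>)"
  \<comment> \<open>Beyond \<open>m0\<close> the fixed initial block \<open>C\<close> contributes
    less than \<open>e / 2\<close> to the mean.\<close>
  obtain m0 :: nat where m0: "2 * C / e < real m0"
    using reals_Archimedean2 by blast
  have "norm ((\<Sum>j<m. r j) / real m - L) < e" if m: "m \<ge> max (Suc m0) n0" for m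
  proof -
    have "m > 0" using m by simp
    have "\<bar>\<Sum>j<m. r j - L\<bar> \<le> (\<Sum>j<m. \<bar>r j - L\<bar>)"
      by (rule sum_abs)
    also have "\<dots> = C + (\<Sum>j=n0..<m. \<bar>r j - L\<bar>)"
      unfolding C_def using m by (simp add: lessThan_atLeast0 sum.atLeastLessThan_concat)
    also have "(\<Sum>j=n0..<m. \<bar>r j - L\<bar>) \<le> (\<Sum>j=n0..<m. e/2)"
      using n0 by (intro sum_mono) (auto intro: less_imp_le)
    also have "\<dots> \<le> real m * (e/2)"
      using e by simp
    also have "C < real m * (e/2)"
    proof -
      have "2 * C / e < real m" using m0 m by simp
      then show ?thesis using e by (simp add: field_simps)
    qed
    finally have "\<bar>\<Sum>j<m. r j - L\<bar> < real m * e"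
      by (simp add: mult.commute)
    moreover have "(\<Sum>j<m. r j) / real m - L = (\<Sum>j<m. r j - L) / real m"
      using \<open>m > 0\<close> by (simp add: sum_subtractf field_simps)
    ultimately show ?thesis
      using \<open>m > 0\<close> by (simp add: divide_less_eq mult.commute)
  qed
  then show "\<exists>no. \<forall>m\<ge>no. norm ((\<Sum>j<m. r j) / real m - L) < e"
    by blast
qed

section \<open>Environments, finite paths and their probabilities\<close>

locale grrw_env =
  fixes f :: "real \<Rightarrow> real" and a0 l0 :: "int \<Rightarrow> real"
  assumes cont_f: "continuous_on {0..1} f"
    and f_ge_half: "y \<in> {0..1} \<Longrightarrow> 1/2 \<le> f y"
    and f_less_1: "y \<in> {0..1} \<Longrightarrow> f y < 1"
    and a0_nonneg: "0 \<le> a0 x" and a0_le_1: "a0 x \<le> 1" and l0_pos: "0 < l0 x"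
begin

definition up_prob :: "int list \<Rightarrow> real" where
  "up_prob xs = f (env_alpha a0 l0 xs (last xs))"

text \<open>The variable compared with \<open>up_prob\<close> may depend on the whole path so far.
  Indexing it by time gives the walk of the theorem, indexing it by site and visit number gives the
  walk that follows arrow stacks.\<close>

primrec src_path :: "(int list \<Rightarrow> real) \<Rightarrow> nat \<Rightarrow> int list" where
  "src_path r 0 = [0]"
| "src_path r (Suc n) = src_path r n @
     [last (src_path r n) + (if r (src_path r n) < up_prob (src_path r n) then 1 else - 1)]"

definition nn_path :: "nat \<Rightarrow> int list \<Rightarrow> bool" where
  "nn_path n xs \<longleftrightarrow> length xs = Suc n \<and> xs ! 0 = 0 \<and> (\<forall>k<n. xs ! Suc k = xs ! k + 1 \<or> xs ! Suc k = xs ! k - 1)"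

text \<open>Since \<open>take (Suc k) xs\<close> is the path up to time \<open>k\<close>, the
  factors are the conditional probabilities of the successive steps.\<close>

definition path_weight :: "nat \<Rightarrow> int list \<Rightarrow> real" where
  "path_weight n xs = (\<Prod>k<n. if xs ! Suc k = xs ! k + 1 then up_prob (take (Suc k) xs) else 1 - up_prob (take (Suc k) xs))"

lemma weighted_mean_in_unit:
  assumes "m \<le> n"
  shows "(a0 x * l0 x + real m) / (l0 x + real n) \<in> {0..1}"
proof -
  have "0 \<le> a0 x * l0 x" "a0 x * l0 x \<le> l0 x"
    using a0_nonneg[of x] a0_le_1[of x] l0_pos[of x] by (simp_all add: mult_le_cancel_right1)
  moreover have "real m \<le> real n"
    using assms by simp
  ultimately have "0 \<le> a0 x * l0 x + real m" "a0 x * l0 x + real m \<le> l0 x + real n"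
    by linarith+
  then show ?thesis
    using l0_pos[of x] by simp
qed

lemma env_alpha_in_unit: "env_alpha a0 l0 xs x \<in> {0..1}"
  unfolding env_alpha_def Let_def by (rule weighted_mean_in_unit) (auto intro!: card_mono)

lemma up_prob_bounds: "1/2 \<le> up_prob xs" "up_prob xs < 1"
  using f_ge_half f_less_1 env_alpha_in_unit by (auto simp: up_prob_def)

lemma length_src_path [simp]: "length (src_path r n) = Suc n"
  by (induction n) auto

lemma last_nth_Suc: "length xs = Suc n \<Longrightarrow> last xs = xs ! n"
  by (subst last_conv_nth) auto

lemma nn_path_snoc:
  "nn_path (Suc n) (ys @ [z]) \<longleftrightarrow> nn_path n ys \<and> (z = last ys + 1 \<or> z = last ys - 1)"
proof (cases "length ys = Suc n")
  case True
  then have "last ys = ys ! n"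
    by (rule last_nth_Suc)
  moreover have "(\<forall>k<n. (ys @ [z]) ! Suc k = (ys @ [z]) ! k + 1 \<or> (ys @ [z]) ! Suc k = (ys @ [z]) ! k - 1) \<longleftrightarrow>
      (\<forall>k<n. ys ! Suc k = ys ! k + 1 \<or> ys ! Suc k = ys ! k - 1)"
    using True by (simp add: nth_append)
  ultimately show ?thesis
    using True by (simp add: nn_path_def All_less_Suc nth_append conj_ac)
qed (auto simp: nn_path_def)

lemma finite_nn_path: "finite {xs. nn_path n xs}"
proof (induction n)
  case 0
  have "{xs. nn_path 0 xs} \<subseteq> {[0]}"
    by (auto simp: nn_path_def length_Suc_conv)
  then show ?case by (rule finite_subset) simp
next
  case (Suc n)
  have "{xs. nn_path (Suc n) xs} \<subseteq> (\<lambda>ys. ys @ [last ys + 1]) ` {xs. nn_path n xs} \<union> (\<lambda>ys. ys @ [last ys - 1]) ` {xs. nn_path n xs}"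
  proof
    fix xs assume xs: "xs \<in> {xs. nn_path (Suc n) xs}"
    then obtain ys z where "xs = ys @ [z]"
      by (cases xs rule: rev_cases) (auto simp: nn_path_def)
    then show "xs \<in> (\<lambda>ys. ys @ [last ys + 1]) ` {xs. nn_path n xs} \<union> (\<lambda>ys. ys @ [last ys - 1]) ` {xs. nn_path n xs}"
      using xs by (auto simp: nn_path_snoc)
  qed
  then show ?case
    using Suc by (auto intro: finite_subset)
qed

lemma nn_path_src_path: "nn_path n (src_path r n)"
  by (induction n) (simp_all add: nn_path_snoc nn_path_def[of 0])

text \<open>Following a prescribed path is a finite system of threshold conditions, of the shape
  handled by \<open>measure_iid_unif_box\<close>.\<close>

lemma src_path_eq_iff:
  "src_path r n = xs \<longleftrightarrow> nn_path n xs \<and>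
     (\<forall>k<n. (r (take (Suc k) xs) < up_prob (take (Suc k) xs)) = (xs ! Suc k = xs ! k + 1))"
proof (induction n arbitrary: xs)
  case 0
  then show ?case by (auto simp: nn_path_def length_Suc_conv)
next
  case (Suc n)
  show ?case
  proof (cases xs rule: rev_cases)
    case Nil
    then show ?thesis by (auto simp: nn_path_def)
  next
    case (snoc ys z)
    show ?thesis
    proof (cases "length ys = Suc n")
      case True
      then have last: "last ys = ys ! n"
        by (rule last_nth_Suc)
      have "(\<forall>k<Suc n. (r (take (Suc k) xs) < up_prob (take (Suc k) xs)) = (xs ! Suc k = xs ! k + 1)) \<longleftrightarrow>
         (\<forall>k<n. (r (take (Suc k) ys) < up_prob (take (Suc k) ys)) = (ys ! Suc k = ys ! k + 1)) \<and>
         (r ys < up_prob ys) = (z = last ys + 1)"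
        unfolding All_less_Suc using True by (auto simp: snoc last nth_append)
      moreover have "src_path r (Suc n) = xs \<longleftrightarrow>
          src_path r n = ys \<and> z = last ys + (if r ys < up_prob ys then 1 else - 1)"
        by (auto simp: snoc)
      ultimately show ?thesis
        using Suc.IH[of ys] by (auto simp: snoc nn_path_snoc)
    next
      case False
      then show ?thesis
        using length_src_path[of r "Suc n"] by (auto simp: snoc nn_path_def simp del: length_src_path)
    qed
  qed
qed

lemma path_weight_snoc:
  assumes "length ys = Suc n"
  shows "path_weight (Suc n) (ys @ [last ys + 1]) = path_weight n ys * up_prob ys"
proof -
  have "path_weight n (ys @ [last ys + 1]) = path_weight n ys"
    unfolding path_weight_def using assms by (intro prod.cong) (auto simp: nth_append)
  then show ?thesis
    using assms last_nth_Suc[OF assms] by (simp add: path_weight_def nth_append)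
qed

end

locale indexed_source = grrw_env f a0 l0 for f a0 l0 +
  fixes h :: "int list \<Rightarrow> 'i" \<comment> \<open>which variable decides the next step, given the path so far\<close>
  assumes inj_index: "nn_path n xs \<Longrightarrow> inj_on (\<lambda>k. h (take (Suc k) xs)) {..<n}"
begin

definition path :: "('i \<Rightarrow> real) \<Rightarrow> nat \<Rightarrow> int list" where
  "path V n = src_path (\<lambda>ys. V (h ys)) n"

definition pos :: "('i \<Rightarrow> real) \<Rightarrow> nat \<Rightarrow> int" where
  "pos V n = last (path V n)"

lemma length_path [simp]: "length (path V n) = Suc n"
  by (simp add: path_def)

lemma path_nth: "k \<le> n \<Longrightarrow> path V n ! k = pos V k"
proof (induction n)
  case (Suc n)
  then show ?case
    using last_nth_Suc[of "path V (Suc n)" "Suc n"]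
    by (cases "k = Suc n") (auto simp: pos_def path_def nth_append)
qed (simp add: pos_def path_def)

lemma path_prefix: "k \<le> n \<Longrightarrow> take (Suc k) (path V n) = path V k"
  by (rule nth_equalityI) (auto simp: path_nth)

lemma pos_0 [simp]: "pos V 0 = 0"
  by (simp add: pos_def path_def)

lemma pos_Suc: "pos V (Suc n) = pos V n + (if V (h (path V n)) < up_prob (path V n) then 1 else - 1)"
  by (simp add: pos_def path_def)

lemma path_measurable [measurable]: "(\<lambda>V. path V n) \<in> measurable iid_unif (count_space UNIV)"
proof (subst measurable_count_space_eq2_countable, intro conjI ballI)
  fix xs :: "int list"
  have "(\<lambda>V. path V n) -` {xs} \<inter> space iid_unif = {V \<in> space iid_unif. nn_path n xs \<and>
     (\<forall>k<n. (V (h (take (Suc k) xs)) < up_prob (take (Suc k) xs)) = (xs ! Suc k = xs ! k + 1))}"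
    unfolding path_def by (simp add: vimage_def src_path_eq_iff)
  also have "\<dots> \<in> sets iid_unif"
    by measurable
  finally show "(\<lambda>V. path V n) -` {xs} \<inter> space iid_unif \<in> sets iid_unif" .
qed auto

lemma pos_measurable [measurable]: "(\<lambda>V. pos V n) \<in> measurable iid_unif (count_space UNIV)"
  unfolding pos_def by measurable

text \<open>By \<open>inj_index\<close> no variable is consulted twice along a path, so the
  threshold conditions are independent. The resulting weight does not mention \<open>h\<close>, so
  the law of the path is the same for every source.\<close>

lemma measure_path_eq:
  "measure iid_unif {V. path V n = xs} = (if nn_path n xs then path_weight n xs else 0)"
proof (cases "nn_path n xs")
  case True
  have "measure iid_unif {V. path V n = xs} =
      measure iid_unif {V. \<forall>k<n. (V (h (take (Suc k) xs)) < up_prob (take (Suc k) xs)) = (xs ! Suc k = xs ! k + 1)}"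
    using True by (simp add: path_def src_path_eq_iff)
  also have "\<dots> = path_weight n xs"
    unfolding path_weight_def
  proof (intro measure_iid_unif_box inj_index True)
    fix k
    show "0 \<le> up_prob (take (Suc k) xs) \<and> up_prob (take (Suc k) xs) \<le> 1"
      using up_prob_bounds[of "take (Suc k) xs"] by simp
  qed
  finally show ?thesis using True by simp
next
  case False
  then have "{V. path V n = xs} = {}"
    by (auto simp: path_def nn_path_src_path)
  with False show ?thesis by simp
qed

text \<open>Conditioning on the path up to time \<open>n\<close> is a sum over finitely many paths;
  given the path \<open>xs\<close>, the next increment has mean
  \<open>2 * up_prob xs - 1\<close>.\<close>

lemma integral_path_step:
  fixes \<phi> :: "int list \<Rightarrow> real"
  shows "(\<integral>V. \<phi> (path V n) * of_int (pos V (Suc n) - pos V n) \<partial>iid_unif) =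
         (\<integral>V. \<phi> (path V n) * (2 * up_prob (path V n) - 1) \<partial>iid_unif)"
proof -
  let ?P = "{xs. nn_path n xs}"
  define E where "E xs = {V. path V n = xs}" for xs
  define E' where "E' xs = {V. path V (Suc n) = xs @ [last xs + 1]}" for xs
  have [measurable]: "E xs \<in> sets iid_unif" "E' xs \<in> sets iid_unif" for xs
  proof -
    have "{V \<in> space iid_unif. path V n = xs} \<in> sets iid_unif"
         "{V \<in> space iid_unif. path V (Suc n) = xs @ [last xs + 1]} \<in> sets iid_unif"
      by measurable
    then show "E xs \<in> sets iid_unif" "E' xs \<in> sets iid_unif"
      by (simp_all add: E_def E'_def)
  qed
  have nn: "path V n \<in> ?P" for V
    by (simp add: path_def nn_path_src_path)
  have step: "of_int (pos V (Suc n) - pos V n) = 2 * indicator (E' (path V n)) V - (1::real)" for V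
    by (auto simp: E'_def pos_Suc path_def pos_def indicator_def)
  have lhs: "\<phi> (path V n) * of_int (pos V (Suc n) - pos V n) =
     (\<Sum>xs\<in>?P. \<phi> xs * (2 * indicator (E' xs) V - indicator (E xs) V))" for V
  proof -
    have "(\<Sum>xs\<in>?P. \<phi> xs * (2 * indicator (E' xs) V - indicator (E xs) V)) =
        (\<Sum>xs\<in>?P. if xs = path V n then \<phi> xs * (2 * indicator (E' xs) V - 1) else 0)"
      by (intro sum.cong refl) (auto simp: E'_def E_def path_def indicator_def)
    also have "\<dots> = \<phi> (path V n) * (2 * indicator (E' (path V n)) V - 1)"
      using nn[of V] finite_nn_path[of n] by (simp add: sum.delta)
    finally show ?thesis unfolding step by simp
  qed
  have rhs: "\<phi> (path V n) * (2 * up_prob (path V n) - 1) =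
     (\<Sum>xs\<in>?P. \<phi> xs * ((2 * up_prob xs - 1) * indicator (E xs) V))" for V
  proof -
    have "(\<Sum>xs\<in>?P. \<phi> xs * ((2 * up_prob xs - 1) * indicator (E xs) V)) =
        (\<Sum>xs\<in>?P. if xs = path V n then \<phi> xs * (2 * up_prob xs - 1) else 0)"
      by (intro sum.cong refl) (auto simp: E_def indicator_def)
    also have "\<dots> = \<phi> (path V n) * (2 * up_prob (path V n) - 1)"
      using nn[of V] finite_nn_path[of n] by (simp add: sum.delta)
    finally show ?thesis by simp
  qed
  have m: "measure iid_unif (E' xs) = measure iid_unif (E xs) * up_prob xs" if "xs \<in> ?P" for xs
  proof -
    have "length xs = Suc n" using that by (simp add: nn_path_def)
    then show ?thesis
      using that by (simp add: E_def E'_def measure_path_eq nn_path_snoc path_weight_snoc)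
  qed
  have "(\<integral>V. \<phi> (path V n) * of_int (pos V (Suc n) - pos V n) \<partial>iid_unif) =
      (\<Sum>xs\<in>?P. \<phi> xs * (2 * measure iid_unif (E' xs) - measure iid_unif (E xs)))"
    unfolding lhs by (subst Bochner_Integration.integral_sum) (auto simp: iid_unif.emeasure_eq_measure)
  also have "\<dots> = (\<Sum>xs\<in>?P. \<phi> xs * ((2 * up_prob xs - 1) * measure iid_unif (E xs)))"
    by (intro sum.cong refl) (simp add: m algebra_simps)
  also have "\<dots> = (\<integral>V. \<phi> (path V n) * (2 * up_prob (path V n) - 1) \<partial>iid_unif)"
    unfolding rhs by (subst Bochner_Integration.integral_sum) (auto simp: iid_unif.emeasure_eq_measure)
  finally show ?thesis .
qed

lemma measure_path_in:
  "emeasure iid_unif {V. path V n \<in> B} = (\<Sum>xs\<in>B \<inter> {xs. nn_path n xs}. ennreal (path_weight n xs))"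
proof -
  have [measurable]: "{V. path V n = xs} \<in> sets iid_unif" for xs
    by (rule iid_unif_sets_Collect) measurable
  have "{V. path V n \<in> B} = (\<Union>xs\<in>B \<inter> {xs. nn_path n xs}. {V. path V n = xs})"
    by (auto simp: path_def nn_path_src_path)
  also have "emeasure iid_unif \<dots> = (\<Sum>xs\<in>B \<inter> {xs. nn_path n xs}. emeasure iid_unif {V. path V n = xs})"
    using finite_nn_path[of n]
    by (intro sum_emeasure[symmetric]) (auto simp: disjoint_family_on_def)
  also have "\<dots> = (\<Sum>xs\<in>B \<inter> {xs. nn_path n xs}. ennreal (path_weight n xs))"
    by (intro sum.cong) (auto simp: iid_unif.emeasure_eq_measure measure_path_eq)
  finally show ?thesis .
qed

lemma integrable_path:
  fixes g :: "int list \<Rightarrow> real"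
  shows "integrable iid_unif (\<lambda>V. g (path V n))"
proof (rule iid_unif.integrable_const_bound)
  show "AE V in iid_unif. norm (g (path V n)) \<le> Max ((\<lambda>xs. norm (g xs)) ` {xs. nn_path n xs})"
    using finite_nn_path[of n] by (intro AE_I2 Max_ge) (auto simp: path_def nn_path_src_path)
qed simp

text \<open>The factor \<open>\<phi>\<close> depends only on the past. Taking for it the indicator
  that a stopping rule has not yet acted turns the martingale identity into optional stopping at a
  bounded time.\<close>

lemma integral_stopped_walk:
  fixes \<phi> :: "int list \<Rightarrow> real"
  shows "(\<integral>V. (\<Sum>j<n. \<phi> (path V j) * of_int (pos V (Suc j) - pos V j)) \<partial>iid_unif) =
         (\<integral>V. (\<Sum>j<n. \<phi> (path V j) * (2 * up_prob (path V j) - 1)) \<partial>iid_unif)"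
proof -
  have "integrable iid_unif (\<lambda>V. \<phi> (path V j) * of_int (pos V (Suc j) - pos V j))" for j
  proof -
    have "\<phi> (path V j) * of_int (pos V (Suc j) - pos V j) =
       (\<lambda>xs. \<phi> (butlast xs) * of_int (last xs - last (butlast xs))) (path V (Suc j))" for V
      by (simp add: path_def pos_def)
    then show ?thesis
      using integrable_path[of "\<lambda>xs. \<phi> (butlast xs) * of_int (last xs - last (butlast xs))" "Suc j"] by simp
  qed
  moreover have "integrable iid_unif (\<lambda>V. \<phi> (path V j) * (2 * up_prob (path V j) - 1))" for j
    using integrable_path[of "\<lambda>xs. \<phi> xs * (2 * up_prob xs - 1)" j] .
  ultimately show ?thesis
    by (simp add: integral_path_step del: of_int_diff)
qed

end

section \<open>Passage from the time-driven walk to the arrow stacks\<close>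

context grrw_env
begin

text \<open>Both sources give every finite path its \<open>path_weight\<close>, so the laws of the
  trajectories agree on cylinders and hence everywhere. Recurrence is a measurable property of the
  trajectory.\<close>

lemma AE_recurrent_index_invariant:
  fixes h :: "int list \<Rightarrow> 'i" and h' :: "int list \<Rightarrow> 'j"
  assumes "indexed_source f a0 l0 h" "indexed_source f a0 l0 h'"
  shows "(AE V in iid_unif. recurrent_path (indexed_source.pos f a0 l0 h V)) \<longleftrightarrow>
         (AE V in iid_unif. recurrent_path (indexed_source.pos f a0 l0 h' V))"
proof -
  interpret H: indexed_source f a0 l0 h by fact
  interpret H': indexed_source f a0 l0 h' by fact
  let ?N = "PiM UNIV (\<lambda>_::nat. count_space (UNIV :: int set))"
  have M: "H.pos \<in> measurable iid_unif ?N" "H'.pos \<in> measurable iid_unif ?N"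
    by (rule measurable_PiM_single'; simp add: space_PiM)+
  have "distr iid_unif ?N H.pos = distr iid_unif ?N H'.pos"
  proof (rule measure_eqI_PiM_infinite)
    fix A :: "nat \<Rightarrow> int set" and J :: "nat set"
    assume J: "finite J"
    obtain n where n: "\<forall>j\<in>J. j \<le> n"
      using J finite_nat_set_iff_bounded_le by blast
    define B where "B = {xs::int list. \<forall>j\<in>J. xs ! j \<in> A j}"
    have S: "prod_emb UNIV (\<lambda>_. count_space UNIV) J (Pi\<^sub>E J A) \<in> sets ?N"
      using J by (intro sets_PiM_I_finite measurable_prod_emb) (auto intro: sets_PiM_I_finite)
    have "H.pos -` prod_emb UNIV (\<lambda>_. count_space UNIV) J (Pi\<^sub>E J A) = {V. H.path V n \<in> B}"
         "H'.pos -` prod_emb UNIV (\<lambda>_. count_space UNIV) J (Pi\<^sub>E J A) = {V. H'.path V n \<in> B}"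
      using n by (auto simp: prod_emb_def B_def H.path_nth H'.path_nth PiE_iff)
    then show "emeasure (distr iid_unif ?N H.pos) (prod_emb UNIV (\<lambda>_. count_space UNIV) J (Pi\<^sub>E J A)) =
        emeasure (distr iid_unif ?N H'.pos) (prod_emb UNIV (\<lambda>_. count_space UNIV) J (Pi\<^sub>E J A))"
      using S M by (simp add: emeasure_distr H.measure_path_in H'.measure_path_in)
  next
    interpret D: prob_space "distr iid_unif ?N H.pos"
      by (rule iid_unif.prob_space_distr) (rule M)
    show "finite_measure (distr iid_unif ?N H.pos)"
      by (rule D.finite_measure_axioms)
  qed simp_all
  moreover have rec: "{X \<in> space ?N. recurrent_path X} \<in> sets ?N"
    unfolding recurrent_path_def infinite_nat_iff_unbounded_le mem_Collect_eq by measurable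
  ultimately show ?thesis
    using AE_distr_iff[OF M(1) rec] AE_distr_iff[OF M(2) rec] by (metis (lifting))
qed

definition stack_index :: "int list \<Rightarrow> int \<times> nat" where
  "stack_index ys = (last ys, card {k. k < length ys - 1 \<and> ys ! k = last ys})"

lemma indexed_source_time: "indexed_source f a0 l0 (\<lambda>ys. length ys - 1)"
proof unfold_locales
  fix n xs assume "nn_path n xs"
  then show "inj_on (\<lambda>k. length (take (Suc k) xs) - 1) {..<n}"
    by (auto simp: inj_on_def nn_path_def)
qed

text \<open>Later visits to a site carry larger visit numbers, so a path never consults the same
  stack entry twice.\<close>

lemma indexed_source_stack: "indexed_source f a0 l0 stack_index"
proof unfold_locales
  fix n xs assume "nn_path n xs"
  then have len: "length xs = Suc n" by (simp add: nn_path_def)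
  have idx: "stack_index (take (Suc k) xs) = (xs ! k, visits_before (nth xs) k (xs ! k))" if "k < n" for k
  proof -
    have "last (take (Suc k) xs) = xs ! k"
      using last_nth_Suc[of "take (Suc k) xs" k] that len by simp
    moreover have "{i. i < k \<and> take (Suc k) xs ! i = xs ! k} = {i. i < k \<and> xs ! i = xs ! k}"
      by auto
    ultimately show ?thesis
      using that len by (simp add: stack_index_def visits_before_def)
  qed
  have less: "visits_before (nth xs) k x < visits_before (nth xs) k' x" if "k < k'" "xs ! k = x" for k k' x
  proof -
    have "visits_before (nth xs) (Suc k) x \<le> visits_before (nth xs) k' x"
      unfolding visits_before_def using that by (intro card_less_Collect_mono) simp
    then show ?thesis
      using that by (simp add: visits_before_Suc)
  qed
  show "inj_on (\<lambda>k. stack_index (take (Suc k) xs)) {..<n}"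
  proof (rule linorder_inj_onI)
    fix k k' assume kk: "k < k'" "k \<in> {..<n}" "k' \<in> {..<n}"
    show "stack_index (take (Suc k) xs) \<noteq> stack_index (take (Suc k') xs)"
      using less[OF kk(1) refl] kk by (auto simp: idx)
  qed auto
qed

sublocale timed: indexed_source f a0 l0 "\<lambda>ys. length ys - 1"
  by (rule indexed_source_time)

sublocale stk: indexed_source f a0 l0 stack_index
  by (rule indexed_source_stack)

lemma grrw_eq_timed: "grrw f a0 l0 U = timed.pos U"
proof
  fix n
  have "grrw_path f a0 l0 U n = timed.path U n" for n
    by (induction n) (auto simp: timed.path_def Let_def up_prob_def simp del: One_nat_def)
  then show "grrw f a0 l0 U n = timed.pos U n"
    by (simp add: grrw_def timed.pos_def del: One_nat_def)
qed

lemma AE_recurrent_grrw_iff: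
  "(AE U in unif_seq. recurrent_path (grrw f a0 l0 U)) \<longleftrightarrow> (AE V in iid_unif. recurrent_path (stk.pos V))"
  unfolding grrw_eq_timed unif_seq_eq_iid_unif
  by (rule AE_recurrent_index_invariant[OF indexed_source_time indexed_source_stack])

text \<open>The urn of every site is run for ever by its own variables, whether or not the walk
  comes back often enough to use them.\<close>

definition stack_alpha :: "(int \<times> nat \<Rightarrow> real) \<Rightarrow> int \<Rightarrow> nat \<Rightarrow> real" where
  "stack_alpha V x j = urn_alpha f (a0 x) (l0 x) (\<lambda>i. V (x, i)) j"

definition arrow :: "(int \<times> nat \<Rightarrow> real) \<Rightarrow> int \<Rightarrow> nat \<Rightarrow> bool" where
  "arrow V x j \<longleftrightarrow> V (x, j) < f (stack_alpha V x j)"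

definition drift :: "(int \<times> nat \<Rightarrow> real) \<Rightarrow> int \<Rightarrow> nat \<Rightarrow> real" where
  "drift V x j = 2 * f (stack_alpha V x j) - 1"

lemma stack_alpha_eq: "stack_alpha V x k = (a0 x * l0 x + real (card {j. j < k \<and> arrow V x j})) / (l0 x + real k)"
  unfolding stack_alpha_def arrow_def using l0_pos by (rule urn_alpha_eq)

lemma stack_alpha_in_unit: "stack_alpha V x k \<in> {0..1}"
proof -
  have "card {j. j < k \<and> arrow V x j} \<le> card {..<k}"
    by (intro card_mono) auto
  then show ?thesis
    unfolding stack_alpha_eq by (intro weighted_mean_in_unit) simp
qed

lemma drift_bounds: "0 \<le> drift V x j" "drift V x j < 1"
  using f_ge_half[OF stack_alpha_in_unit[of V x j]] f_less_1[OF stack_alpha_in_unit[of V x j]]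
  by (auto simp: drift_def)

lemma stack_index_path: "stack_index (stk.path V n) = (stk.pos V n, visits_before (stk.pos V) n (stk.pos V n))"
proof -
  have "{k. k < n \<and> stk.path V n ! k = stk.pos V n} = {k. k < n \<and> stk.pos V k = stk.pos V n}"
    by (auto simp: stk.path_nth)
  then show ?thesis
    by (simp add: stack_index_def visits_before_def flip: stk.pos_def)
qed

lemma env_alpha_path:
  "env_alpha a0 l0 (stk.path V n) x =
     (a0 x * l0 x + real (ups_before (stk.pos V) n x)) / (l0 x + real (visits_before (stk.pos V) n x))"
proof -
  have "{k. k < n \<and> stk.path V n ! k = x} = {k. k < n \<and> stk.pos V k = x}"
       "{k. k < n \<and> stk.path V n ! k = x \<and> stk.path V n ! Suc k = x + 1} =
        {k. k < n \<and> stk.pos V k = x \<and> stk.pos V (Suc k) = x + 1}"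
    by (auto simp: stk.path_nth)
  then show ?thesis
    by (simp add: env_alpha_def visits_before_def ups_before_def)
qed

text \<open>Induction along the walk: the environment seen at a site equals the composition of its
  urn after as many draws as there were visits, so the next step is the next arrow of the
  stack.\<close>

lemma ups_before_pos:
  "ups_before (stk.pos V) n x = card {j. j < visits_before (stk.pos V) n x \<and> arrow V x j}"
proof (induction n arbitrary: x)
  case (Suc n)
  let ?x = "stk.pos V n"
  have "up_prob (stk.path V n) = f (stack_alpha V ?x (visits_before (stk.pos V) n ?x))"
    by (simp add: up_prob_def env_alpha_path Suc.IH stack_alpha_eq flip: stk.pos_def)
  then have "stk.pos V (Suc n) = ?x + 1 \<longleftrightarrow> arrow V ?x (visits_before (stk.pos V) n ?x)"
    by (simp add: stk.pos_Suc stack_index_path arrow_def)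
  then show ?case
    by (auto simp: ups_before_Suc visits_before_Suc card_less_Suc_Collect Suc.IH)
qed simp

lemma up_prob_path: "up_prob (stk.path V n) = f (stack_alpha V (stk.pos V n) (visits_before (stk.pos V) n (stk.pos V n)))"
  by (simp add: up_prob_def env_alpha_path ups_before_pos stack_alpha_eq flip: stk.pos_def)

lemma stack_walk_pos: "stack_walk (arrow V) (stk.pos V)"
  by unfold_locales (simp_all add: stk.pos_Suc up_prob_path stack_index_path arrow_def)

lemma drift_path: "2 * up_prob (stk.path V n) - 1 = drift V (stk.pos V n) (visits_before (stk.pos V) n (stk.pos V n))"
  by (simp add: up_prob_path drift_def)

lemma f_bounded_away: "\<exists>c\<ge>0. c < 1 \<and> (\<forall>y\<in>{0..1}. f y \<le> c)"
proof -
  obtain y where y: "y \<in> {0..1}" "\<forall>z\<in>{0..1}. f z \<le> f y"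
    using continuous_attains_sup[of "{0..1::real}" f] cont_f by auto
  then show ?thesis
    using f_less_1[of y] f_ge_half[of y] by (intro exI[of _ "f y"]) auto
qed

text \<open>With \<open>c < 1\<close> bounding \<open>f\<close>, a variable below 1/2 makes an up
  arrow and one not below \<open>c\<close> a down arrow, whatever the urn composition. Both kinds
  almost surely occur beyond every height \<open>m\<close>.\<close>

lemma AE_full_stack: "AE V in iid_unif. full_stack_walk (arrow V) (stk.pos V)"
proof -
  obtain c where c: "0 \<le> c" "c < 1" "\<forall>y\<in>{0..1}. f y \<le> c"
    using f_bounded_away by blast
  have "AE V in iid_unif. \<exists>k. \<not> V (x, m + k) < c" for x :: int and m :: nat
    using c by (intro AE_iid_unif_ex_ge) (auto simp: inj_def)
  then have "AE V in iid_unif. \<forall>x::int. \<forall>m::nat. \<exists>k. \<not> V (x, m + k) < c"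
    by (simp add: AE_all_countable)
  moreover have "AE V in iid_unif. \<exists>k. V (x, m + k) < 1/2" for x :: int and m :: nat
    by (intro AE_iid_unif_ex_less) (auto simp: inj_def)
  then have "AE V in iid_unif. \<forall>x::int. \<forall>m::nat. \<exists>k. V (x, m + k) < 1/2"
    by (simp add: AE_all_countable)
  ultimately show ?thesis
  proof eventually_elim
    case (elim V)
    interpret stack_walk "arrow V" "stk.pos V" by (rule stack_walk_pos)
    show ?case
    proof
      fix x
      have "\<exists>j\<ge>m. arrow V x j" for m
      proof -
        obtain k where "V (x, m + k) < 1/2" using elim by blast
        then have "arrow V x (m + k)"
          using f_ge_half[OF stack_alpha_in_unit[of V x "m + k"]] by (simp add: arrow_def)
        then show ?thesis by (intro exI[of _ "m + k"]) simp
      qed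
      then show "infinite {j. arrow V x j}"
        by (auto simp: infinite_nat_iff_unbounded_le)
      have "\<exists>j\<ge>m. \<not> arrow V x j" for m
      proof -
        obtain k where "\<not> V (x, m + k) < c" using elim by blast
        then have "\<not> arrow V x (m + k)"
          using c(3) stack_alpha_in_unit[of V x "m + k"] by (force simp: arrow_def)
        then show ?thesis by (intro exI[of _ "m + k"]) simp
      qed
      then show "infinite {j. \<not> arrow V x j}"
        by (auto simp: infinite_nat_iff_unbounded_le)
    qed
  qed
qed

section \<open>Measurability and hitting times\<close>

text \<open>Nothing is known about \<open>f\<close> outside the unit interval, so \<open>f\<close> itself need not be measurable.\<close>

lemma f_clamp_measurable: "(\<lambda>y. f (max 0 (min 1 y))) \<in> borel_measurable borel"
  by (intro borel_measurable_continuous_onI continuous_on_compose2[OF cont_f] continuous_intros) auto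

lemma stack_alpha_measurable [measurable]: "(\<lambda>V. stack_alpha V x k) \<in> borel_measurable iid_unif"
proof (induction k)
  case 0
  then show ?case by (simp add: stack_alpha_def)
next
  case (Suc k)
  note [measurable] = Suc f_clamp_measurable
  have "stack_alpha V x (Suc k) = (if V (x, k) < f (max 0 (min 1 (stack_alpha V x k)))
      then ((l0 x + real k) * stack_alpha V x k + 1) / (l0 x + real k + 1)
      else (l0 x + real k) * stack_alpha V x k / (l0 x + real k + 1))" for V
    using stack_alpha_in_unit[of V x k] by (simp add: stack_alpha_def Let_def)
  then show ?case by simp
qed

lemma f_stack_alpha_measurable [measurable]: "(\<lambda>V. f (stack_alpha V x k)) \<in> borel_measurable iid_unif"
proof -
  note [measurable] = f_clamp_measurable
  have "f (stack_alpha V x k) = f (max 0 (min 1 (stack_alpha V x k)))" for V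
    using stack_alpha_in_unit[of V x k] by simp
  then show ?thesis by simp
qed

lemma drift_measurable [measurable]: "(\<lambda>V. drift V x k) \<in> borel_measurable iid_unif"
  unfolding drift_def by measurable

lemma arrow_measurable [measurable]: "Measurable.pred iid_unif (\<lambda>V. arrow V x k)"
  unfolding arrow_def by measurable

lemma cross_count_measurable [measurable]:
  "(\<lambda>V. cross_count (arrow V) j x) \<in> measurable iid_unif (count_space UNIV)"
  by (induction j arbitrary: x) (simp_all add: downs_before_up_def)

lemma stack_alpha_cong: "(\<And>i. V (x, i) = W (x, i)) \<Longrightarrow> stack_alpha V x = stack_alpha W x"
  by (rule ext) (simp add: stack_alpha_def)

lemma arrow_cong: "(\<And>i. V (x, i) = W (x, i)) \<Longrightarrow> arrow V x = arrow W x"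
  using stack_alpha_cong[of V x W] by (auto simp: arrow_def)

lemma drift_cong: "(\<And>i. V (x, i) = W (x, i)) \<Longrightarrow> drift V x = drift W x"
  using stack_alpha_cong[of V x W] by (auto simp: drift_def)

text \<open>The factor switches off all increments after the first visit to \<open>k\<close>, so the
  sum telescopes to the walk frozen there.\<close>

lemma stopped_at_level:
  assumes "0 \<le> k"
  shows "(\<Sum>j<n. (if k \<in> set (stk.path V j) then 0 else 1) * real_of_int (stk.pos V (Suc j) - stk.pos V j)) =
         (if k \<in> set (stk.path V n) then of_int k else of_int (stk.pos V n))"
proof (induction n)
  case 0
  then show ?case by (simp add: stk.path_def)
next
  case (Suc n)
  have "set (stk.path V (Suc n)) = insert (stk.pos V (Suc n)) (set (stk.path V n))"
    by (simp add: stk.path_def stk.pos_def)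
  with Suc show ?case by auto
qed

lemma set_path: "set (stk.path V n) = stk.pos V ` {..n}"
proof (induction n)
  case (Suc n)
  have "stk.path V (Suc n) = stk.path V n @ [stk.pos V (Suc n)]"
    by (simp add: stk.path_def stk.pos_def)
  with Suc show ?case by (simp add: atMost_Suc)
qed (simp add: stk.path_def)

lemma pos_less_level:
  assumes "0 \<le> k" "k \<notin> set (stk.path V n)"
  shows "stk.pos V n < k"
proof -
  interpret stack_walk "arrow V" "stk.pos V" by (rule stack_walk_pos)
  show ?thesis
    using first_hit_exists[of k n] assms by (force simp: set_path first_hit_def)
qed

lemma integral_drift_until_level:
  assumes "0 \<le> k"
  shows "(\<integral>V. (\<Sum>j<n. (if k \<in> set (stk.path V j) then 0 else 1) * (2 * up_prob (stk.path V j) - 1)) \<partial>iid_unif) =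
         (\<integral>V. (if k \<in> set (stk.path V n) then of_int k else of_int (stk.pos V n)) \<partial>iid_unif)"
  unfolding stopped_at_level[OF assms, symmetric]
  by (rule stk.integral_stopped_walk[symmetric])

lemma integrable_stopped_at_level:
  "integrable iid_unif (\<lambda>V. (if k \<in> set (stk.path V n) then of_int k else of_int (stk.pos V n)) :: real)"
  using stk.integrable_path[of "\<lambda>xs. if k \<in> set xs then of_int k else of_int (last xs)" n]
  unfolding stk.pos_def by simp

lemma prob_far_left_before_level:
  assumes "0 < k"
  shows "measure iid_unif {V. k \<notin> set (stk.path V n) \<and> stk.pos V n < - int m} \<le> of_int k / (of_int k + real m)"
proof -
  define S where "S V = (if k \<in> set (stk.path V n) then of_int k else of_int (stk.pos V n) :: real)" for V
  define B where "B = {V. k \<notin> set (stk.path V n) \<and> stk.pos V n < - int m}"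
  have [measurable]: "B \<in> sets iid_unif"
    unfolding B_def by (rule iid_unif_sets_Collect) measurable
  have int: "integrable iid_unif S"
    unfolding S_def by (rule integrable_stopped_at_level)
  have "0 \<le> (\<integral>V. S V \<partial>iid_unif)"
  proof -
    have "0 \<le> 2 * up_prob xs - 1" for xs
      using up_prob_bounds(1)[of xs] by simp
    then show ?thesis
      unfolding S_def using assms
      by (subst integral_drift_until_level[symmetric]) (auto intro!: integral_nonneg_AE AE_I2 sum_nonneg)
  qed
  have "(of_int k + real m) * measure iid_unif B = (\<integral>V. (of_int k + real m) * indicator B V \<partial>iid_unif)"
    by simp
  also have "\<dots> \<le> (\<integral>V. of_int k - S V \<partial>iid_unif)"
  proof (rule integral_mono)
    fix V
    show "(of_int k + real m) * indicator B V \<le> of_int k - S V"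
      using pos_less_level[of k V n] assms
      by (auto simp: S_def B_def indicator_def)
  qed (use int in \<open>auto simp: iid_unif.emeasure_eq_measure\<close>)
  also have "\<dots> \<le> of_int k"
    using int \<open>0 \<le> (\<integral>V. S V \<partial>iid_unif)\<close> by simp
  finally show ?thesis
    using assms by (simp add: B_def field_simps)
qed

text \<open>By \<open>escapes_left\<close>, a walk that misses \<open>k\<close> ends up below every
  \<open>-m\<close> for good; the bound of \<open>prob_far_left_before_level\<close> tends to 0 as
  \<open>m\<close> grows.\<close>

lemma AE_hits_level:
  assumes "0 < k"
  shows "AE V in iid_unif. \<exists>n. stk.pos V n = k"
proof -
  define B where "B m N = {V. \<forall>n\<ge>N. k \<notin> set (stk.path V n) \<and> stk.pos V n < - int m}" for m N
  have B [measurable]: "B m N \<in> sets iid_unif" for m N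
    unfolding B_def by (rule iid_unif_sets_Collect) measurable
  have "measure iid_unif (B m N) \<le> of_int k / (of_int k + real m)" for m N
  proof -
    have "{V \<in> space iid_unif. k \<notin> set (stk.path V N) \<and> stk.pos V N < - int m} \<in> sets iid_unif"
      by measurable
    then have "measure iid_unif (B m N) \<le> measure iid_unif {V. k \<notin> set (stk.path V N) \<and> stk.pos V N < - int m}"
      by (intro iid_unif.finite_measure_mono) (auto simp: B_def)
    then show ?thesis
      using prob_far_left_before_level[OF assms, of N m] by simp
  qed
  moreover have "(\<lambda>N. measure iid_unif (B m N)) \<longlonglongrightarrow> measure iid_unif (\<Union>N. B m N)" for m
  proof (rule iid_unif.finite_Lim_measure_incseq)
    show "range (B m) \<subseteq> sets iid_unif" using B by auto
    show "incseq (B m)" by (auto simp: incseq_def B_def)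
  qed
  ultimately have bound: "measure iid_unif (\<Union>N. B m N) \<le> of_int k / (of_int k + real m)" for m
    by (intro LIMSEQ_le_const2[of "\<lambda>N. measure iid_unif (B m N)"]) auto
  have "measure iid_unif (\<Inter>m. \<Union>N. B m N) \<le> of_int k / (of_int k + real m)" for m
  proof -
    have "measure iid_unif (\<Inter>m. \<Union>N. B m N) \<le> measure iid_unif (\<Union>N. B m N)"
      by (intro iid_unif.finite_measure_mono) auto
    then show ?thesis using bound[of m] by simp
  qed
  moreover have "(\<lambda>m. of_int k / (of_int k + real m)) \<longlonglongrightarrow> 0"
    by (intro tendsto_divide_0[OF tendsto_const] filterlim_at_top_imp_at_infinity
        filterlim_tendsto_add_at_top[OF tendsto_const] filterlim_real_sequentially)
  ultimately have "measure iid_unif (\<Inter>m. \<Union>N. B m N) \<le> 0"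
    by (intro LIMSEQ_le_const[of "\<lambda>m. of_int k / (of_int k + real m)"]) auto
  then have "emeasure iid_unif (\<Inter>m. \<Union>N. B m N) = 0"
    by (simp add: iid_unif.emeasure_eq_measure measure_le_0_iff)
  then have "AE V in iid_unif. V \<notin> (\<Inter>m. \<Union>N. B m N)"
    by (intro AE_not_in null_setsI) auto
  with AE_full_stack show ?thesis
  proof eventually_elim
    case (elim V)
    interpret full_stack_walk "arrow V" "stk.pos V" by fact
    show ?case
    proof (rule ccontr)
      assume no: "\<not> ?thesis"
      have "V \<in> (\<Union>N. B m N)" for m
      proof -
        obtain N where "\<forall>n\<ge>N. stk.pos V n < - int m"
          using escapes_left[of k m] no assms by auto
        then show ?thesis
          using no by (auto simp: B_def set_path)
      qed
      with elim show False by blast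
    qed
  qed
qed

lemma AE_right_reaching: "AE V in iid_unif. right_reaching_stack_walk (arrow V) (stk.pos V)"
proof -
  have "AE V in iid_unif. 0 < k \<longrightarrow> (\<exists>n. stk.pos V n = k)" for k
    using AE_hits_level[of k] by (cases "0 < k") auto
  then have "AE V in iid_unif. \<forall>k. 0 < k \<longrightarrow> (\<exists>n. stk.pos V n = k)"
    by (simp add: AE_all_countable)
  then show ?thesis
  proof eventually_elim
    case (elim V)
    interpret stack_walk "arrow V" "stk.pos V" by (rule stack_walk_pos)
    show ?case
    proof
      fix k :: int assume "0 \<le> k"
      then show "\<exists>n. stk.pos V n = k"
        using elim X_0 by (cases "k = 0") (auto intro!: exI[of _ 0])
    qed
  qed
qed

section \<open>Drift accumulated before a hitting time\<close>

lemma cross_count_arrow_cong: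
  assumes "\<And>z i. x < z \<Longrightarrow> z \<le> x + int j \<Longrightarrow> V (z, i) = W (z, i)"
  shows "cross_count (arrow V) j x = cross_count (arrow W) j x"
  using assms by (intro cross_count_cong arrow_cong)

text \<open>By the martingale identity the integral is the mean of the walk frozen at
  \<open>k\<close>, which never exceeds \<open>k\<close>.\<close>

lemma integral_drift_until_level_le:
  assumes "0 \<le> k"
  shows "(\<integral>\<^sup>+V. ennreal (\<Sum>j<n. (if k \<in> set (stk.path V j) then 0 else 1) * (2 * up_prob (stk.path V j) - 1)) \<partial>iid_unif)
     \<le> ennreal (of_int k)"
proof -
  let ?G = "\<lambda>V. \<Sum>j<n. (if k \<in> set (stk.path V j) then 0 else 1) * (2 * up_prob (stk.path V j) - 1)"
  have nonneg: "0 \<le> 2 * up_prob xs - 1" for xs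
    using up_prob_bounds(1)[of xs] by simp
  have "integrable iid_unif ?G"
    by (intro Bochner_Integration.integrable_sum stk.integrable_path[of "\<lambda>xs. (if k \<in> set xs then 0 else 1) * (2 * up_prob xs - 1)"])
  then have "(\<integral>\<^sup>+V. ennreal (?G V) \<partial>iid_unif) = ennreal (\<integral>V. ?G V \<partial>iid_unif)"
    using nonneg by (intro nn_integral_eq_integral AE_I2 sum_nonneg) auto
  also have "(\<integral>V. ?G V \<partial>iid_unif) \<le> (\<integral>V. of_int k \<partial>(iid_unif :: (int \<times> nat \<Rightarrow> real) measure))"
    unfolding integral_drift_until_level[OF assms]
    using pos_less_level[OF assms] less_imp_le
    by (intro integral_mono integrable_stopped_at_level) auto
  finally show ?thesis by (simp add: ennreal_leI)
qed

text \<open>Take for \<open>n\<close> the first hitting time of \<open>k\<close>. A site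
  \<open>x\<close> stepped back onto \<open>N\<close> times from \<open>x + 1\<close> has been
  visited at least \<open>N\<close> times by then, so its first \<open>N\<close> drifts have been
  consumed; drift consumed elsewhere is nonnegative.\<close>

lemma drift_sum_le_drift_until_level:
  assumes "right_reaching_stack_walk (arrow V) (stk.pos V)"
  shows "\<exists>n. (\<Sum>x=1..<k. if N \<le> cross_count (arrow V) (k - 1 - x) (int x) then \<Sum>i<N. drift V (int x) i else 0)
    \<le> (\<Sum>j<n. (if int k \<in> set (stk.path V j) then 0 else 1) * (2 * up_prob (stk.path V j) - 1))"
proof -
  interpret right_reaching_stack_walk "arrow V" "stk.pos V" by fact
  obtain n where n: "first_hit (stk.pos V) n (int k)"
    using first_hit_hits[of "int k"] by auto
  let ?d = "\<lambda>j. drift V (stk.pos V j) (visits_before (stk.pos V) j (stk.pos V j))"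
  have "(if N \<le> cross_count (arrow V) (k - 1 - x) (int x) then \<Sum>i<N. drift V (int x) i else 0)
      \<le> (\<Sum>j<n. if stk.pos V j = int x then ?d j else 0)" if x: "x \<in> {1..<k}" for x
  proof -
    have "N \<le> visits_before (stk.pos V) n (int x)" if "N \<le> cross_count (arrow V) (k - 1 - x) (int x)"
    proof -
      have k: "int x + 1 + int (k - 1 - x) = int k"
        using x by auto
      note that
      also have "cross_count (arrow V) (k - 1 - x) (int x) = downs_before (stk.pos V) n (int x + 1)"
        using downs_before_first_hit[of n "int x" "k - 1 - x", unfolded k, OF n] by simp
      also have "\<dots> \<le> ups_before (stk.pos V) n (int x)"
        using ups_before_balance[of "int x" n] by simp
      also have "\<dots> \<le> card {..<visits_before (stk.pos V) n (int x)}"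
        unfolding ups_before_eq by (intro card_mono) auto
      finally show ?thesis by simp
    qed
    then have "(if N \<le> cross_count (arrow V) (k - 1 - x) (int x) then \<Sum>i<N. drift V (int x) i else 0)
        \<le> (\<Sum>i<visits_before (stk.pos V) n (int x). drift V (int x) i)"
      using drift_bounds(1) by (auto intro!: sum_mono2 sum_nonneg)
    also have "\<dots> = (\<Sum>j<n. if stk.pos V j = int x then ?d j else 0)"
      by (rule sum_by_visits[symmetric])
    finally show ?thesis .
  qed
  then have "(\<Sum>x=1..<k. if N \<le> cross_count (arrow V) (k - 1 - x) (int x) then \<Sum>i<N. drift V (int x) i else 0)
     \<le> (\<Sum>x=1..<k. \<Sum>j<n. if stk.pos V j = int x then ?d j else 0)"
    by (rule sum_mono)
  also have "\<dots> = (\<Sum>j<n. \<Sum>x=1..<k. if stk.pos V j = int x then ?d j else 0)"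
    by (rule sum.swap)
  also have "\<dots> \<le> (\<Sum>j<n. ?d j)"
  proof (rule sum_mono)
    fix j
    have "(\<Sum>x=1..<k. if stk.pos V j = int x then ?d j else 0) =
        (\<Sum>x=1..<k. if x = nat (stk.pos V j) then (if 0 \<le> stk.pos V j then ?d j else 0) else 0)"
      by (intro sum.cong) auto
    also have "\<dots> \<le> ?d j"
      using drift_bounds(1) by (subst sum.delta) auto
    finally show "(\<Sum>x=1..<k. if stk.pos V j = int x then ?d j else 0) \<le> ?d j" .
  qed
  also have "\<dots> = (\<Sum>j<n. (if int k \<in> set (stk.path V j) then 0 else 1) * (2 * up_prob (stk.path V j) - 1))"
  proof (rule sum.cong)
    fix j assume "j \<in> {..<n}"
    then have "int k \<notin> set (stk.path V j)"
      using n by (auto simp: set_path first_hit_def dest: le_less_trans)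
    then show "?d j = (if int k \<in> set (stk.path V j) then 0 else 1) * (2 * up_prob (stk.path V j) - 1)"
      by (simp add: drift_path)
  qed simp
  finally show ?thesis by blast
qed

section \<open>Excursions to the right\<close>

text \<open>At time 0 nothing is alive: the excursion begins with the arrival at 1, and it is over
  from its first visit to 0 or \<open>k\<close> on, whatever the walk does later.\<close>

definition excursion_alive :: "int \<Rightarrow> int list \<Rightarrow> bool" where
  "excursion_alive k xs \<longleftrightarrow> 2 \<le> length xs \<and> xs ! 1 = 1 \<and> (\<forall>i\<in>{1..<length xs}. xs ! i \<noteq> 0 \<and> xs ! i \<noteq> k)"

lemma excursion_alive_path:
  "excursion_alive k (stk.path V n) \<longleftrightarrow>
     1 \<le> n \<and> stk.pos V 1 = 1 \<and> (\<forall>i. 1 \<le> i \<longrightarrow> i \<le> n \<longrightarrow> stk.pos V i \<noteq> 0 \<and> stk.pos V i \<noteq> k)"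
proof (cases "1 \<le> n")
  case True
  then have "stk.path V n ! 1 = stk.pos V 1"
    by (rule stk.path_nth)
  moreover have "(\<forall>i\<in>{1..<Suc n}. stk.path V n ! i \<noteq> 0 \<and> stk.path V n ! i \<noteq> k) \<longleftrightarrow>
     (\<forall>i. 1 \<le> i \<longrightarrow> i \<le> n \<longrightarrow> stk.pos V i \<noteq> 0 \<and> stk.pos V i \<noteq> k)"
    by (auto simp: stk.path_nth)
  ultimately show ?thesis
    using True by (simp add: excursion_alive_def)
qed (simp add: excursion_alive_def)

text \<open>The step from 0 to 1 is not part of the sum. A completed excursion therefore gains
  \<open>k - 1\<close> if it ends at \<open>k\<close> and loses 1 if it ends at 0.\<close>

definition excursion_gain :: "int \<Rightarrow> (int \<times> nat \<Rightarrow> real) \<Rightarrow> nat \<Rightarrow> real" where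
  "excursion_gain k V n = (\<Sum>i<n. of_bool (excursion_alive k (stk.path V i)) * of_int (stk.pos V (Suc i) - stk.pos V i))"

lemma excursion_gain_eq_0:
  assumes "stk.pos V 1 \<noteq> 1"
  shows "excursion_gain k V n = 0"
  using assms by (auto simp: excursion_gain_def excursion_alive_path)

text \<open>The three clauses are proved together because the value at the end of the excursion
  comes from the value while alive one step earlier.\<close>

lemma excursion_gain_cases:
  assumes "stk.pos V 1 = 1" "1 \<le> k" "1 \<le> n"
  shows "(excursion_alive k (stk.path V n) \<longrightarrow> excursion_gain k V n = of_int (stk.pos V n) - 1 \<and> 1 \<le> stk.pos V n) \<and>
    (\<not> excursion_alive k (stk.path V n) \<longrightarrow> - 1 \<le> excursion_gain k V n) \<and>
    (\<not> excursion_alive k (stk.path V n) \<and> (\<exists>m. 1 \<le> m \<and> m \<le> n \<and> stk.pos V m = k \<and> (\<forall>i. 1 \<le> i \<longrightarrow> i \<le> m \<longrightarrow> stk.pos V i \<noteq> 0))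
       \<longrightarrow> excursion_gain k V n = of_int k - 1)"
  using assms(3)
proof (induction n rule: dec_induct)
  case base
  have "excursion_gain k V 1 = 0"
    by (simp add: excursion_gain_def excursion_alive_path)
  then show ?case
    using assms by (auto simp: excursion_alive_path dest: le_antisym)
next
  case (step n)
  interpret stack_walk "arrow V" "stk.pos V" by (rule stack_walk_pos)
  have step1: "stk.pos V (Suc n) \<ge> stk.pos V n - 1"
    by (simp add: X_Suc)
  show ?case
  proof (cases "excursion_alive k (stk.path V n)")
    case True
    then have gain: "excursion_gain k V (Suc n) = of_int (stk.pos V (Suc n)) - 1" and pos: "1 \<le> stk.pos V n"
      using step.IH by (simp_all add: excursion_gain_def)
    have "m = Suc n" if "1 \<le> m" "m \<le> Suc n" "stk.pos V m = k" for m
      using True that by (auto simp: excursion_alive_path le_Suc_eq)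
    moreover have "excursion_alive k (stk.path V (Suc n)) \<longleftrightarrow> stk.pos V (Suc n) \<noteq> 0 \<and> stk.pos V (Suc n) \<noteq> k"
      using True by (auto simp: excursion_alive_path le_Suc_eq)
    ultimately show ?thesis
      using gain pos step1 by force
  next
    case False
    then have gain: "excursion_gain k V (Suc n) = excursion_gain k V n"
      by (simp add: excursion_gain_def)
    have dead: "\<not> excursion_alive k (stk.path V (Suc n))"
      using False step.hyps by (auto simp: excursion_alive_path)
    \<comment> \<open>The excursion has ended by time \<open>n\<close>, at 0 or at \<open>k\<close>.
      If no zero occurs up to \<open>m = Suc n\<close>, it ended at \<open>k\<close>, which supplies
      a witness not exceeding \<open>n\<close>.\<close>
    have "\<exists>m. 1 \<le> m \<and> m \<le> n \<and> stk.pos V m = k \<and> (\<forall>i. 1 \<le> i \<longrightarrow> i \<le> m \<longrightarrow> stk.pos V i \<noteq> 0)"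
      if m: "1 \<le> m" "m \<le> Suc n" "stk.pos V m = k" "\<forall>i. 1 \<le> i \<longrightarrow> i \<le> m \<longrightarrow> stk.pos V i \<noteq> 0" for m
    proof (cases "m \<le> n")
      case True
      then show ?thesis using m by blast
    next
      case False
      then have "m = Suc n" using m by simp
      moreover obtain i where i: "1 \<le> i" "i \<le> n" "stk.pos V i = 0 \<or> stk.pos V i = k"
        using \<open>\<not> excursion_alive k (stk.path V n)\<close> step.hyps assms(1) by (auto simp: excursion_alive_path)
      ultimately have "stk.pos V i = k" using m(4) by auto
      then show ?thesis
        using i m(4) \<open>m = Suc n\<close> by (intro exI[of _ i]) auto
    qed
    then show ?thesis
      using step.IH False dead unfolding gain by blast
  qed
qed

text \<open>After a first step up, \<open>cross_count (arrow V) j 0 = 0\<close> means that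
  \<open>Suc j\<close> is reached without a return to 0, giving the gain \<open>j\<close> once it
  has been hit; the gain never falls below -1. Without a first step up the gain is 0.\<close>

lemma excursion_gain_lower:
  "real (Suc j) * of_bool (arrow V 0 0 \<and> cross_count (arrow V) j 0 = 0 \<and> (\<exists>i\<le>n. stk.pos V i = int (Suc j)))
     - of_bool (arrow V 0 0) \<le> excursion_gain (int (Suc j)) V n"
proof -
  interpret stack_walk "arrow V" "stk.pos V" by (rule stack_walk_pos)
  show ?thesis
  proof (cases "arrow V 0 0")
    case False
    then show ?thesis
      using X_1 by (simp add: excursion_gain_eq_0)
  next
    case up: True
    then have X1: "stk.pos V 1 = 1" using X_1 by simp
    show ?thesis
    proof (cases "1 \<le> n")
      case False
      then have "n = 0" by simp
      then show ?thesis using X_0 by (simp add: excursion_gain_def)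
    next
      case True
      note cases = excursion_gain_cases[OF X1 _ True, of "int (Suc j)"]
      have "- 1 \<le> excursion_gain (int (Suc j)) V n"
        using cases by (cases "excursion_alive (int (Suc j)) (stk.path V n)") auto
      moreover have "excursion_gain (int (Suc j)) V n = real (Suc j) - 1"
        if cc: "cross_count (arrow V) j 0 = 0" and hit: "i \<le> n" "stk.pos V i = int (Suc j)" for i
      proof -
        obtain m where m: "m \<le> i" "first_hit (stk.pos V) m (1 + int j)"
          using first_hit_exists[of "1 + int j" i] hit by auto
        then have "stk.pos V m = int (Suc j)"
          by (simp add: first_hit_def)
        moreover have "m \<noteq> 0"
          using calculation X_0 by (metis of_nat_0 of_nat_eq_iff nat.distinct(1))
        moreover have "stk.pos V i' \<noteq> 0" if "1 \<le> i'" "i' \<le> m" for i'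
          using positive_until_first_hit[OF up cc m(2) that] by simp
        ultimately have "1 \<le> m \<and> m \<le> n \<and> stk.pos V m = int (Suc j) \<and> (\<forall>i'. 1 \<le> i' \<longrightarrow> i' \<le> m \<longrightarrow> stk.pos V i' \<noteq> 0)"
          using m(1) hit(1) by auto
        moreover from this have "\<not> excursion_alive (int (Suc j)) (stk.path V n)"
          by (auto simp: excursion_alive_path)
        ultimately show ?thesis
          using cases by auto
      qed
      ultimately show ?thesis
        using up by (cases "cross_count (arrow V) j 0 = 0 \<and> (\<exists>i\<le>n. stk.pos V i = int (Suc j))") auto
    qed
  qed
qed

section \<open>Drift consumed by an excursion, site by site\<close>

definition excursion_drift :: "int \<Rightarrow> (int \<times> nat \<Rightarrow> real) \<Rightarrow> nat \<Rightarrow> int \<Rightarrow> real" where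
  "excursion_drift k V n x = (\<Sum>i<n. of_bool (excursion_alive k (stk.path V i) \<and> stk.pos V i = x) * (2 * up_prob (stk.path V i) - 1))"

text \<open>While alive, the walk is strictly between 0 and \<open>k\<close>, so each such time is
  counted at exactly one of these sites.\<close>

lemma sum_excursion_drift:
  assumes "1 \<le> k"
  shows "(\<Sum>i<n. of_bool (excursion_alive (int k) (stk.path V i)) * (2 * up_prob (stk.path V i) - 1)) =
     (\<Sum>x=1..<k. excursion_drift (int k) V n (int x))"
proof -
  have "of_bool (excursion_alive (int k) (stk.path V i)) * (2 * up_prob (stk.path V i) - 1) =
      (\<Sum>x=1..<k. of_bool (excursion_alive (int k) (stk.path V i) \<and> stk.pos V i = int x) * (2 * up_prob (stk.path V i) - 1))" for i
  proof (cases "excursion_alive (int k) (stk.path V i)")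
    case True
    then have *: "1 \<le> i" "stk.pos V 1 = 1" "\<forall>m. 1 \<le> m \<longrightarrow> m \<le> i \<longrightarrow> stk.pos V m \<noteq> int k"
      by (auto simp: excursion_alive_path)
    have "1 \<le> stk.pos V i"
      using excursion_gain_cases[OF *(2) _ *(1), of "int k"] True assms by auto
    moreover have "int k \<notin> set (stk.path V i)"
    proof
      assume "int k \<in> set (stk.path V i)"
      then obtain m where "m \<le> i" "stk.pos V m = int k"
        by (auto simp: set_path)
      then show False
        using * assms by (cases m) auto
    qed
    then have "stk.pos V i < int k"
      using pos_less_level[of "int k" V i] by simp
    moreover have "(\<Sum>x=1..<k. of_bool (stk.pos V i = int x)) = (\<Sum>x=1..<k. if x = nat (stk.pos V i) then 1 else (0::real))"
      using \<open>1 \<le> stk.pos V i\<close> by (intro sum.cong) auto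
    ultimately have "(\<Sum>x=1..<k. of_bool (stk.pos V i = int x)) = (1::real)"
      by (simp add: sum.delta nat_less_iff)
    then show ?thesis
      using True by (simp flip: sum_distrib_right)
  qed simp
  then have "(\<Sum>i<n. of_bool (excursion_alive (int k) (stk.path V i)) * (2 * up_prob (stk.path V i) - 1)) =
     (\<Sum>i<n. \<Sum>x=1..<k. of_bool (excursion_alive (int k) (stk.path V i) \<and> stk.pos V i = int x) * (2 * up_prob (stk.path V i) - 1))"
    by (rule sum.cong[OF refl])
  also have "\<dots> = (\<Sum>x=1..<k. excursion_drift (int k) V n (int x))"
    unfolding excursion_drift_def by (rule sum.swap)
  finally show ?thesis .
qed

lemma excursion_drift_le_visits:
  "excursion_drift k V n x \<le> (\<Sum>i<visits_before (stk.pos V) n x. drift V x i)"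
proof -
  have "excursion_drift k V n x \<le>
     (\<Sum>i<n. if stk.pos V i = x then drift V (stk.pos V i) (visits_before (stk.pos V) i (stk.pos V i)) else 0)"
    unfolding excursion_drift_def drift_path using drift_bounds(1) by (intro sum_mono) auto
  also have "\<dots> = (\<Sum>i<visits_before (stk.pos V) n x. drift V x i)"
    by (rule sum_by_visits)
  finally show ?thesis .
qed

lemma excursion_drift_nonneg: "0 \<le> excursion_drift k V n x"
  unfolding excursion_drift_def drift_path using drift_bounds(1) by (intro sum_nonneg) auto

text \<open>A live visit to \<open>Suc m\<close> requires a first step up and no step from 1 to 0
  before \<open>Suc m\<close> is hit.\<close>

lemma excursion_drift_eq_0:
  assumes "\<not> (arrow V 0 0 \<and> cross_count (arrow V) m 0 = 0)"
  shows "excursion_drift k V n (int (Suc m)) = 0"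
proof -
  interpret stack_walk "arrow V" "stk.pos V" by (rule stack_walk_pos)
  have "\<not> (excursion_alive k (stk.path V i) \<and> stk.pos V i = int (Suc m))" for i
    using cross_count_eq_0_if_reached[of i m] X_1 assms by (auto simp: excursion_alive_path)
  then show ?thesis
    unfolding excursion_drift_def by (intro sum.neutral ballI) (metis mult_zero_left of_bool_eq(1))
qed

definition total_drift :: "(int \<times> nat \<Rightarrow> real) \<Rightarrow> int \<Rightarrow> ennreal" where
  "total_drift V x = (\<Sum>i. ennreal (drift V x i))"

definition later_drift :: "(int \<times> nat \<Rightarrow> real) \<Rightarrow> int \<Rightarrow> ennreal" where
  "later_drift V x = (\<Sum>i. of_bool (i \<noteq> 0) * ennreal (drift V x i))"

lemma total_drift_split: "total_drift V x = ennreal (drift V x 0) + later_drift V x"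
proof -
  have "total_drift V x = (\<Sum>i. (if i = 0 then ennreal (drift V x 0) else 0) + of_bool (i \<noteq> 0) * ennreal (drift V x i))"
    unfolding total_drift_def by (intro suminf_cong) simp
  also have "\<dots> = (\<Sum>i. if i = 0 then ennreal (drift V x 0) else 0) + later_drift V x"
    unfolding later_drift_def by (intro suminf_add[symmetric] summableI)
  also have "(\<Sum>i. if i = 0 then ennreal (drift V x 0) else 0) = ennreal (drift V x 0)"
    using suminf_finite[of "{0}" "\<lambda>i. if i = 0 then ennreal (drift V x 0) else 0"] by simp
  finally show ?thesis .
qed

lemma total_drift_measurable [measurable]: "(\<lambda>V. total_drift V x) \<in> borel_measurable iid_unif"
  unfolding total_drift_def by measurable

lemma later_drift_measurable [measurable]: "(\<lambda>V. later_drift V x) \<in> borel_measurable iid_unif"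
  unfolding later_drift_def by measurable

lemma excursion_drift_plus_unused_le:
  assumes "right_reaching_stack_walk (arrow V) (stk.pos V)"
  shows "ennreal (excursion_drift k V n (int (Suc m)))
     + of_bool (arrow V 0 0 \<and> cross_count (arrow V) m 0 = 0) *
       (of_bool (arrow V (int (Suc m)) 0) * later_drift V (int (Suc m)) *
        of_bool (\<forall>j. cross_count (arrow V) j (int (Suc m)) = 0))
     \<le> of_bool (arrow V 0 0 \<and> cross_count (arrow V) m 0 = 0) * total_drift V (int (Suc m))"
proof (cases "arrow V 0 0 \<and> cross_count (arrow V) m 0 = 0")
  case False
  then have "of_bool (arrow V 0 0 \<and> cross_count (arrow V) m 0 = 0) = (0::ennreal)"
    by simp
  then show ?thesis
    unfolding excursion_drift_eq_0[OF False, of k n] by (simp only: mult_zero_left) simp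
next
  case True
  interpret right_reaching_stack_walk "arrow V" "stk.pos V" by fact
  let ?x = "int (Suc m)"
  show ?thesis
  proof (cases "arrow V ?x 0 \<and> (\<forall>j. cross_count (arrow V) j ?x = 0)")
    case escape: True
    have "visits_before (stk.pos V) n ?x \<le> 1"
    proof (induction n)
      case (Suc n)
      then show ?case
        using visited_at_most_once[of ?x n] escape by (auto simp: visits_before_Suc)
    qed simp
    then have "(\<Sum>i<visits_before (stk.pos V) n ?x. drift V ?x i) \<le> (\<Sum>i<1. drift V ?x i)"
      using drift_bounds(1) by (intro sum_mono2) auto
    then have "excursion_drift k V n ?x \<le> drift V ?x 0"
      using excursion_drift_le_visits[of k V n ?x] by simp
    then have "ennreal (excursion_drift k V n ?x) \<le> ennreal (drift V ?x 0)"
      by (rule ennreal_leI)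
    then show ?thesis
      using True escape by (simp add: total_drift_split add_right_mono)
  next
    case False
    have "ennreal (excursion_drift k V n ?x) \<le> ennreal (\<Sum>i<visits_before (stk.pos V) n ?x. drift V ?x i)"
      by (rule ennreal_leI[OF excursion_drift_le_visits])
    also have "\<dots> = (\<Sum>i<visits_before (stk.pos V) n ?x. ennreal (drift V ?x i))"
      using drift_bounds(1) by (simp add: sum_ennreal)
    also have "\<dots> \<le> total_drift V ?x"
      unfolding total_drift_def by (intro sum_le_suminf summableI) auto
    finally show ?thesis
      using True False by auto
  qed
qed

text \<open>This is \<open>p\<close> of the overview. The event concerns the stacks from site 1 on
  only; for a walk that hits all levels to the right it says that no step from 1 to 0 is ever
  made.\<close>

definition escape_prob :: real where
  "escape_prob = measure iid_unif {V. \<forall>j. cross_count (arrow V) j 0 = 0}"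

text \<open>This is \<open>b\<^sub>k\<close> of the overview for \<open>k = Suc j\<close>: the first
  step goes up and \<open>Suc j\<close> is then reached before a return to 0.\<close>

definition reach_prob :: "nat \<Rightarrow> real" where
  "reach_prob j = measure iid_unif {V. arrow V 0 0 \<and> cross_count (arrow V) j 0 = 0}"

definition mean_drift :: ennreal where
  "mean_drift = (\<integral>\<^sup>+V. total_drift V 1 \<partial>iid_unif)"

text \<open>This is \<open>h\<close> of the overview, an expectation over the event of a first up
  arrow that is not divided by the probability of the event.\<close>

definition mean_later_drift :: ennreal where
  "mean_later_drift = (\<integral>\<^sup>+V. of_bool (arrow V 1 0) * later_drift V 1 \<partial>iid_unif)"

lemma nn_integral_of_bool:
  "Measurable.pred iid_unif P \<Longrightarrow> (\<integral>\<^sup>+V. of_bool (P V) \<partial>iid_unif) = ennreal (measure iid_unif {V. P V})"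
proof -
  assume P: "Measurable.pred iid_unif P"
  have "(\<integral>\<^sup>+V. of_bool (P V) \<partial>iid_unif) = (\<integral>\<^sup>+V. indicator {V. P V} V \<partial>iid_unif)"
    by (intro nn_integral_cong) (simp add: indicator_def)
  then show ?thesis
    using iid_unif_sets_Collect[OF P] by (simp add: iid_unif.emeasure_eq_measure)
qed

lemma excursion_drift_measurable [measurable]: "(\<lambda>V. excursion_drift k V n x) \<in> borel_measurable iid_unif"
  unfolding excursion_drift_def by measurable

lemma total_drift_cong: "(\<And>i. V (x, i) = W (x, i)) \<Longrightarrow> total_drift V x = total_drift W x"
  unfolding total_drift_def by (simp add: drift_cong[of V x W])

lemma later_drift_cong: "(\<And>i. V (x, i) = W (x, i)) \<Longrightarrow> later_drift V x = later_drift W x"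
  unfolding later_drift_def by (simp add: drift_cong[of V x W])

lemma mean_later_drift_le: "mean_later_drift \<le> mean_drift"
  unfolding mean_later_drift_def mean_drift_def
  by (intro nn_integral_mono) (simp add: total_drift_split)

text \<open>After \<open>n + 1\<close> draws of which one plus the floor of \<open>y * n\<close> are
  up, the composition tends to \<open>y\<close> as \<open>n\<close> grows, and \<open>f\<close> is
  continuous. The additional up arrow provides \<open>1 \<le> m\<close>.\<close>

lemma reachable_urn_drift:
  assumes "y \<in> {0..1}" "1/2 < f y"
  shows "\<exists>K m. 1 \<le> m \<and> m \<le> K \<and> 1/2 < f ((a0 1 * l0 1 + real m) / (l0 1 + real K))"
proof -
  define \<alpha> where "\<alpha> n = (a0 1 * l0 1 + real (Suc (nat \<lfloor>y * real n\<rfloor>))) / (l0 1 + real (Suc n))" for n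
  have le: "Suc (nat \<lfloor>y * real n\<rfloor>) \<le> Suc n" for n
  proof -
    have "y * real n \<le> real n"
      using assms(1) by (simp add: mult_left_le_one_le)
    then show ?thesis by (simp add: floor_le_iff nat_le_iff)
  qed
  have "\<alpha> \<longlonglongrightarrow> y"
  proof (rule tendsto_sandwich)
    have lim: "(\<lambda>n. y + C / (l0 1 + real (Suc n))) \<longlonglongrightarrow> y + 0" for C
      by (intro tendsto_add tendsto_const tendsto_divide_0[OF tendsto_const] filterlim_at_top_imp_at_infinity
          filterlim_tendsto_add_at_top[OF tendsto_const]
          filterlim_compose[OF filterlim_real_sequentially filterlim_Suc])
    show "(\<lambda>n. y + (a0 1 * l0 1 - y * (l0 1 + 1)) / (l0 1 + real (Suc n))) \<longlonglongrightarrow> y"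
         "(\<lambda>n. y + (a0 1 * l0 1 + 1 - y * (l0 1 + 1)) / (l0 1 + real (Suc n))) \<longlonglongrightarrow> y"
      using lim by auto
    have pos: "0 < l0 1 + real (Suc n)" for n
      using l0_pos[of 1] by simp
    have fl: "real (nat \<lfloor>y * real n\<rfloor>) \<le> y * real n" "y * real n - 1 \<le> real (nat \<lfloor>y * real n\<rfloor>)" for n
      using assms(1) by (simp_all add: of_nat_nat floor_le_iff)
    have "y + (a0 1 * l0 1 - y * (l0 1 + 1)) / (l0 1 + real (Suc n)) = (a0 1 * l0 1 + y * real n) / (l0 1 + real (Suc n))" for n
      using pos[of n] by (simp add: field_simps)
    moreover have "(a0 1 * l0 1 + y * real n) / (l0 1 + real (Suc n)) \<le> \<alpha> n" for n
      unfolding \<alpha>_def using fl(2)[of n] pos[of n] by (intro divide_right_mono) auto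
    ultimately show "\<forall>\<^sub>F n in sequentially. y + (a0 1 * l0 1 - y * (l0 1 + 1)) / (l0 1 + real (Suc n)) \<le> \<alpha> n"
      by simp
    have "y + (a0 1 * l0 1 + 1 - y * (l0 1 + 1)) / (l0 1 + real (Suc n)) = (a0 1 * l0 1 + 1 + y * real n) / (l0 1 + real (Suc n))" for n
      using pos[of n] by (simp add: field_simps)
    moreover have "\<alpha> n \<le> (a0 1 * l0 1 + 1 + y * real n) / (l0 1 + real (Suc n))" for n
      unfolding \<alpha>_def using fl(1)[of n] pos[of n] by (intro divide_right_mono) auto
    ultimately show "\<forall>\<^sub>F n in sequentially. \<alpha> n \<le> y + (a0 1 * l0 1 + 1 - y * (l0 1 + 1)) / (l0 1 + real (Suc n))"
      by simp
  qed
  moreover have "\<alpha> n \<in> {0..1}" for n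
    unfolding \<alpha>_def using le by (rule weighted_mean_in_unit)
  ultimately have "(\<lambda>n. f (\<alpha> n)) \<longlonglongrightarrow> f y"
    using assms(1) by (intro continuous_on_tendsto_compose[OF cont_f]) auto
  then have "\<forall>\<^sub>F n in sequentially. 1/2 < f (\<alpha> n)"
    by (rule order_tendstoD(1)) (rule assms(2))
  then obtain n where "1/2 < f (\<alpha> n)"
    by (auto simp: eventually_sequentially)
  then show ?thesis
    using le[of n] unfolding \<alpha>_def by (intro exI[of _ "Suc n"] exI[of _ "Suc (nat \<lfloor>y * real n\<rfloor>)"]) auto
qed

text \<open>If \<open>f\<close> were 1/2 throughout, \<open>mean_drift\<close> would vanish; so some
  composition reachable after a first up arrow has positive drift. The pattern of \<open>m\<close>
  up arrows followed by \<open>K - m\<close> down arrows leads to it with positive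
  probability.\<close>

lemma mean_later_drift_pos:
  assumes "0 < mean_drift"
  shows "0 < mean_later_drift"
proof -
  have "\<exists>y\<in>{0..1}. 1/2 < f y"
  proof (rule ccontr)
    assume "\<not> ?thesis"
    then have "drift V 1 i = 0" for V i
      using f_ge_half[OF stack_alpha_in_unit[of V 1 i]] stack_alpha_in_unit[of V 1 i]
      by (force simp: drift_def)
    then have "mean_drift = 0"
      by (simp add: mean_drift_def total_drift_def)
    with assms show False by simp
  qed
  then obtain K m where Km: "1 \<le> m" "m \<le> K" "1/2 < f ((a0 1 * l0 1 + real m) / (l0 1 + real K))"
    using reachable_urn_drift by blast
  \<comment> \<open>Along the pattern, \<open>min i m\<close> of the first \<open>i\<close> arrows
    are up, so \<open>c i\<close> is the deterministic up probability at height \<open>i\<close> and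
    \<open>Pat\<close> becomes a box.\<close>
  define c where "c i = f ((a0 1 * l0 1 + real (min i m)) / (l0 1 + real i))" for i
  define Pat :: "(int \<times> nat \<Rightarrow> real) set" where "Pat = {V. \<forall>i<K. (V (1, i) < c i) = (i < m)}"
  have c: "0 < c i" "c i < 1" for i
    using f_ge_half[OF weighted_mean_in_unit[of "min i m" i 1]] f_less_1[OF weighted_mean_in_unit[of "min i m" i 1]]
    by (auto simp: c_def)
  have Pat [measurable]: "Pat \<in> sets iid_unif"
    unfolding Pat_def by (rule iid_unif_sets_Collect) measurable
  have "measure iid_unif Pat = (\<Prod>i<K. if i < m then c i else 1 - c i)"
    unfolding Pat_def by (intro measure_iid_unif_box) (use c in \<open>auto simp: inj_on_def intro: less_imp_le\<close>)
  also have "\<dots> > 0"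
    using c by (intro prod_pos) auto
  finally have Pat_pos: "0 < measure iid_unif Pat" .
  let ?e = "2 * f ((a0 1 * l0 1 + real m) / (l0 1 + real K)) - 1"
  have "ennreal ?e * indicator Pat V \<le> of_bool (arrow V 1 0) * later_drift V 1" for V
  proof (cases "V \<in> Pat")
    case True
    have ar: "arrow V 1 i \<longleftrightarrow> i < m" if "i < K" for i
      using that
    proof (induction i rule: less_induct)
      case (less i)
      then have "{j. j < i \<and> arrow V 1 j} = {..<min i m}" by auto
      then have "stack_alpha V 1 i = (a0 1 * l0 1 + real (min i m)) / (l0 1 + real i)"
        by (simp add: stack_alpha_eq)
      then show ?case
        using True less.prems by (simp add: arrow_def Pat_def c_def)
    qed
    then have "{j. j < K \<and> arrow V 1 j} = {..<m}"
      using Km by auto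
    then have "drift V 1 K = ?e"
      by (simp add: drift_def stack_alpha_eq)
    moreover have "of_bool (K \<noteq> 0) * ennreal (drift V 1 K) \<le> later_drift V 1"
    proof -
      define g where [abs_def]: "g i = of_bool (i \<noteq> 0) * ennreal (drift V 1 i)" for i
      have "g K \<le> suminf g"
        using sum_le_suminf[of g "{K}"] by (simp add: summableI)
      then show ?thesis
        by (simp only: g_def later_drift_def)
    qed
    ultimately show ?thesis
      using True ar[of 0] Km by simp
  qed simp
  then have "(\<integral>\<^sup>+V. ennreal ?e * indicator Pat V \<partial>iid_unif) \<le> mean_later_drift"
    unfolding mean_later_drift_def by (intro nn_integral_mono)
  moreover have "(\<integral>\<^sup>+V. ennreal ?e * indicator Pat V \<partial>iid_unif) = ennreal ?e * ennreal (measure iid_unif Pat)"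
    by (simp add: nn_integral_cmult_indicator iid_unif.emeasure_eq_measure)
  moreover have "0 < ennreal ?e * ennreal (measure iid_unif Pat)"
    using Km(3) Pat_pos by (simp add: ennreal_zero_less_mult_iff)
  ultimately show ?thesis by simp
qed

lemma reach_prob_decseq: "decseq reach_prob"
proof (rule decseq_SucI)
  fix j
  have [measurable]: "{V. arrow V 0 0 \<and> cross_count (arrow V) i 0 = 0} \<in> sets iid_unif" for i
    by (rule iid_unif_sets_Collect) measurable
  show "reach_prob (Suc j) \<le> reach_prob j"
    unfolding reach_prob_def
  proof (rule iid_unif.finite_measure_mono_AE, use AE_right_reaching in eventually_elim)
    case (elim V)
    interpret right_reaching_stack_walk "arrow V" "stk.pos V" by fact
    show ?case using cross_count_mono[of j] by auto
  qed measurable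
qed

text \<open>A variable below 1/2 at height 0 of site 0 forces a first step up because
  \<open>f \<ge> 1/2\<close>, and it is independent of the stacks from 1 on. The bound keeps the
  limit of \<open>reach_prob\<close> positive.\<close>

lemma escape_prob_le_reach_prob: "escape_prob / 2 \<le> reach_prob j"
proof -
  let ?E = "\<lambda>V. \<forall>j. cross_count (arrow V) j 0 = 0"
  have "(\<integral>\<^sup>+V. of_bool (V (0, 0) < 1/2) * of_bool (?E V) \<partial>iid_unif) =
      (\<integral>\<^sup>+V. of_bool (V (0::int, 0::nat) < 1/2) \<partial>iid_unif) * (\<integral>\<^sup>+V. of_bool (?E V) \<partial>iid_unif)"
  proof (rule nn_integral_iid_unif_indep[where J = "{0} \<times> UNIV" and K = "{0<..} \<times> UNIV"])
    show "of_bool (?E V) = of_bool (?E W)" if "\<And>p. p \<in> {0<..} \<times> UNIV \<Longrightarrow> V p = W p" for V W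
    proof -
      have "cross_count (arrow V) j 0 = cross_count (arrow W) j 0" for j
        using that by (intro cross_count_arrow_cong) auto
      then show ?thesis by simp
    qed
  qed auto
  also have "(\<integral>\<^sup>+V. of_bool (V (0::int, 0::nat) < 1/2) \<partial>iid_unif) = ennreal (measure iid_unif {V. V (0::int, 0::nat) < 1/2})"
    by (rule nn_integral_of_bool) measurable
  also have "measure iid_unif {V. V (0::int, 0::nat) < 1/2} = 1/2"
    using measure_iid_unif_box[of "\<lambda>_. (0::int, 0::nat)" 1 "\<lambda>_. 1/2" "\<lambda>_. True"]
    by (simp add: inj_on_def)
  also have "(\<integral>\<^sup>+V. of_bool (?E V) \<partial>iid_unif) = ennreal escape_prob"
    unfolding escape_prob_def by (rule nn_integral_of_bool) measurable
  finally have "ennreal (1/2) * ennreal escape_prob = (\<integral>\<^sup>+V. of_bool (V (0, 0) < 1/2) * of_bool (?E V) \<partial>iid_unif)" ..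
  also have "\<dots> \<le> (\<integral>\<^sup>+V. of_bool (arrow V 0 0 \<and> cross_count (arrow V) j 0 = 0) \<partial>iid_unif)"
  proof (rule nn_integral_mono)
    fix V
    have "V (0, 0) < 1/2 \<Longrightarrow> arrow V 0 0"
      using f_ge_half[OF stack_alpha_in_unit[of V 0 0]] by (simp add: arrow_def)
    then show "of_bool (V (0, 0) < 1/2) * of_bool (?E V) \<le> (of_bool (arrow V 0 0 \<and> cross_count (arrow V) j 0 = 0) :: ennreal)"
      by auto
  qed
  also have "\<dots> = ennreal (reach_prob j)"
    unfolding reach_prob_def by (rule nn_integral_of_bool) measurable
  finally have "ennreal (1/2 * escape_prob) \<le> ennreal (reach_prob j)"
    by (subst ennreal_mult) (auto simp: escape_prob_def)
  then show ?thesis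
    by (subst (asm) ennreal_le_iff) (auto simp: reach_prob_def)
qed

text \<open>Otherwise the steps from 1 to 0 are almost surely unbounded in number, so 1 is visited
  infinitely often, and full stacks spread this to all sites.\<close>

lemma bounded_cross_count_if_transient:
  assumes "\<not> (AE V in iid_unif. recurrent_path (stk.pos V))"
  shows "\<exists>N. 0 < measure iid_unif {V. \<forall>j. cross_count (arrow V) j 0 \<le> N}"
proof (rule ccontr)
  assume "\<not> ?thesis"
  then have zero: "measure iid_unif {V. \<forall>j. cross_count (arrow V) j 0 \<le> N} = 0" for N
    by (simp add: not_less measure_le_0_iff)
  have "AE V in iid_unif. V \<notin> {V. \<forall>j. cross_count (arrow V) j 0 \<le> N}" for N
    by (intro AE_not_in null_setsI)
       (auto simp: iid_unif.emeasure_eq_measure zero intro!: iid_unif_sets_Collect)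
  then have "AE V in iid_unif. \<forall>N. V \<notin> {V. \<forall>j. cross_count (arrow V) j 0 \<le> N}"
    by (simp add: AE_all_countable)
  then have "AE V in iid_unif. recurrent_path (stk.pos V)"
    using AE_right_reaching AE_full_stack
  proof eventually_elim
    case (elim V)
    interpret right_reaching_stack_walk "arrow V" "stk.pos V" by fact
    interpret full_stack_walk "arrow V" "stk.pos V" by fact
    have "infinite {n. stk.pos V n = 1}"
      using cross_count_bounded elim(1) by blast
    then show ?case
      using infinite_all_sites unfolding recurrent_path_def by blast
  qed
  with assms show False by simp
qed

end

section \<open>Homogeneous half-line\<close>

locale grrw_homogeneous = grrw_env +
  assumes homogeneous: "1 \<le> x \<Longrightarrow> a0 x = a0 1 \<and> l0 x = l0 1"
begin

definition shift_index :: "int \<Rightarrow> int \<times> nat \<Rightarrow> int \<times> nat" where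
  "shift_index c p = (fst p + c, snd p)"

lemma inj_shift_index: "inj (shift_index c)"
  by (auto simp: inj_def shift_index_def prod_eq_iff)

text \<open>The constant stretch of the initial environment starts at site 1, which is why
  \<open>z\<close> is at least 1 and shifts go to the right.\<close>

lemma stack_alpha_shift:
  "1 \<le> z \<Longrightarrow> 0 \<le> c \<Longrightarrow> stack_alpha (\<lambda>p. V (shift_index c p)) z = stack_alpha V (z + c)"
  using homogeneous[of z] homogeneous[of "z + c"] by (auto simp: stack_alpha_def shift_index_def)

lemma arrow_shift: "1 \<le> z \<Longrightarrow> 0 \<le> c \<Longrightarrow> arrow (\<lambda>p. V (shift_index c p)) z = arrow V (z + c)"
  by (rule ext) (simp add: arrow_def stack_alpha_shift, simp add: shift_index_def)

lemma drift_shift: "1 \<le> z \<Longrightarrow> 0 \<le> c \<Longrightarrow> drift (\<lambda>p. V (shift_index c p)) z = drift V (z + c)"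
  by (rule ext) (simp add: drift_def stack_alpha_shift)

lemma cross_count_arrow_shift:
  assumes "0 \<le> x"
  shows "cross_count (arrow (\<lambda>p. V (shift_index x p))) j 0 = cross_count (arrow V) j x"
proof -
  have "cross_count (arrow (\<lambda>p. V (shift_index x p))) j 0 = cross_count (\<lambda>z. arrow V (z + x)) j 0"
    using assms by (intro cross_count_cong arrow_shift) auto
  also have "\<dots> = cross_count (arrow V) j x"
    by (simp add: cross_count_shift)
  finally show ?thesis .
qed

section \<open>Recurrence bounds the mean drift\<close>

lemma nn_integral_drift_sum_shift:
  assumes "1 \<le> x"
  shows "(\<integral>\<^sup>+V. ennreal (\<Sum>i<N. drift V x i) \<partial>iid_unif) = (\<integral>\<^sup>+V. ennreal (\<Sum>i<N. drift V 1 i) \<partial>iid_unif)"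
proof -
  have "(\<integral>\<^sup>+V. ennreal (\<Sum>i<N. drift (\<lambda>p. V (shift_index (x - 1) p)) 1 i) \<partial>iid_unif) = (\<integral>\<^sup>+V. ennreal (\<Sum>i<N. drift V 1 i) \<partial>iid_unif)"
    by (rule nn_integral_iid_unif_reindex[OF inj_shift_index]) measurable
  then show ?thesis
    using assms by (simp add: drift_shift)
qed

lemma measure_cross_count_shift:
  assumes "0 \<le> x"
  shows "measure iid_unif {V. N \<le> cross_count (arrow V) j x} = measure iid_unif {V. N \<le> cross_count (arrow V) j 0}"
proof -
  have "measure iid_unif {V. N \<le> cross_count (arrow (\<lambda>p. V (shift_index x p))) j 0} = measure iid_unif {V. N \<le> cross_count (arrow V) j 0}"
    by (rule measure_iid_unif_reindex[OF inj_shift_index]) measurable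
  then show ?thesis
    by (simp only: cross_count_arrow_shift[OF assms])
qed

text \<open>For the sites below \<open>k = Suc m\<close>, sum the drift of the first
  \<open>N\<close> arrows on the event that the site is stepped back onto \<open>N\<close> times.
  The event depends on stacks to the right only, so each expectation factorises; the total is at
  most \<open>k\<close> by stopping at \<open>k\<close>.\<close>

lemma partial_drift_times_return_prob_le:
  "(\<integral>\<^sup>+V. ennreal (\<Sum>i<N. drift V 1 i) \<partial>iid_unif) *
     ennreal (\<Sum>j<m. measure iid_unif {V. N \<le> cross_count (arrow V) j 0}) \<le> ennreal (real (Suc m))"
proof -
  let ?k = "Suc m"
  let ?G = "\<lambda>n V. ennreal (\<Sum>j<n. (if int ?k \<in> set (stk.path V j) then 0 else 1) * (2 * up_prob (stk.path V j) - 1))"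
  let ?D = "\<integral>\<^sup>+V. ennreal (\<Sum>i<N. drift V 1 i) \<partial>iid_unif"
  let ?I = "\<lambda>x V. indicator {V. N \<le> cross_count (arrow V) (?k - 1 - x) (int x)} V :: ennreal"
  have nonneg: "0 \<le> 2 * up_prob xs - 1" for xs
    using up_prob_bounds(1)[of xs] by simp
  have ev [measurable]: "{V. N \<le> cross_count (arrow V) j x} \<in> sets iid_unif" for j x
    by (rule iid_unif_sets_Collect) measurable
  have site: "(\<integral>\<^sup>+V. ennreal (\<Sum>i<N. drift V (int x) i) * ?I x V \<partial>iid_unif) =
      ?D * ennreal (measure iid_unif {V. N \<le> cross_count (arrow V) (?k - 1 - x) 0})" if x: "x \<in> {1..<?k}" for x
  proof -
    have "(\<integral>\<^sup>+V. ennreal (\<Sum>i<N. drift V (int x) i) * ?I x V \<partial>iid_unif) =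
       (\<integral>\<^sup>+V. ennreal (\<Sum>i<N. drift V (int x) i) \<partial>iid_unif) * (\<integral>\<^sup>+V. ?I x V \<partial>iid_unif)"
    proof (rule nn_integral_iid_unif_indep[where J = "{int x} \<times> UNIV" and K = "{int x<..} \<times> UNIV"])
      fix V W :: "int \<times> nat \<Rightarrow> real" assume "\<And>i. i \<in> {int x} \<times> UNIV \<Longrightarrow> V i = W i"
      then have "drift V (int x) = drift W (int x)"
        by (intro drift_cong) auto
      then show "ennreal (\<Sum>i<N. drift V (int x) i) = ennreal (\<Sum>i<N. drift W (int x) i)"
        by simp
    next
      fix V W :: "int \<times> nat \<Rightarrow> real" assume "\<And>i. i \<in> {int x<..} \<times> UNIV \<Longrightarrow> V i = W i"
      then have "cross_count (arrow V) (?k - 1 - x) (int x) = cross_count (arrow W) (?k - 1 - x) (int x)"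
        by (intro cross_count_arrow_cong) auto
      then show "?I x V = ?I x W"
        by (simp add: indicator_def)
    qed auto
    then show ?thesis
      using x nn_integral_drift_sum_shift[of "int x" N] measure_cross_count_shift[of "int x" N "?k - 1 - x"]
      by (simp add: iid_unif.emeasure_eq_measure)
  qed
  have "?D * ennreal (\<Sum>j<m. measure iid_unif {V. N \<le> cross_count (arrow V) j 0}) =
      (\<Sum>j<m. ?D * ennreal (measure iid_unif {V. N \<le> cross_count (arrow V) j 0}))"
    using sum_ennreal[of "{..<m}" "\<lambda>j. measure iid_unif {V. N \<le> cross_count (arrow V) j 0}"]
    by (simp add: sum_distrib_left[symmetric])
  \<comment> \<open>The site \<open>x\<close> corresponds to the distance \<open>j = m - x\<close>,
    so homogeneity turns the sum over sites into one over distances.\<close>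
  also have "\<dots> = (\<Sum>x=1..<?k. ?D * ennreal (measure iid_unif {V. N \<le> cross_count (arrow V) (?k - 1 - x) 0}))"
    by (rule sum.reindex_bij_witness[of _ "\<lambda>x. m - x" "\<lambda>j. m - j"]) auto
  also have "\<dots> = (\<Sum>x=1..<?k. \<integral>\<^sup>+V. ennreal (\<Sum>i<N. drift V (int x) i) * ?I x V \<partial>iid_unif)"
    by (rule sum.cong[OF refl]) (rule site[symmetric])
  also have "\<dots> = (\<integral>\<^sup>+V. (\<Sum>x=1..<?k. ennreal (\<Sum>i<N. drift V (int x) i) * ?I x V) \<partial>iid_unif)"
    by (subst nn_integral_sum) auto
  \<comment> \<open>The hitting time of \<open>k\<close> is almost surely finite but not bounded, so
    the drift up to it is reached through the supremum over deterministic times.\<close>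
  also have "\<dots> \<le> (\<integral>\<^sup>+V. (SUP n. ?G n V) \<partial>iid_unif)"
  proof (rule nn_integral_mono_AE, use AE_right_reaching in eventually_elim)
    case (elim V)
    obtain n where n: "(\<Sum>x=1..<?k. if N \<le> cross_count (arrow V) (?k - 1 - x) (int x) then \<Sum>i<N. drift V (int x) i else 0)
      \<le> (\<Sum>j<n. (if int ?k \<in> set (stk.path V j) then 0 else 1) * (2 * up_prob (stk.path V j) - 1))"
      using drift_sum_le_drift_until_level[OF elim] by blast
    have "(\<Sum>x=1..<?k. ennreal (\<Sum>i<N. drift V (int x) i) * ?I x V) =
       (\<Sum>x=1..<?k. ennreal (if N \<le> cross_count (arrow V) (?k - 1 - x) (int x) then \<Sum>i<N. drift V (int x) i else 0))"
      by (rule sum.cong) (simp_all add: indicator_def)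
    also have "\<dots> = ennreal (\<Sum>x=1..<?k. if N \<le> cross_count (arrow V) (?k - 1 - x) (int x) then \<Sum>i<N. drift V (int x) i else 0)"
      using drift_bounds(1) by (intro sum_ennreal) (auto intro: sum_nonneg)
    also have "\<dots> \<le> ?G n V"
      by (rule ennreal_leI[OF n])
    also have "\<dots> \<le> (SUP n. ?G n V)"
      by (rule SUP_upper) simp
    finally show ?case .
  qed
  also have "\<dots> = (SUP n. \<integral>\<^sup>+V. ?G n V \<partial>iid_unif)"
    using nonneg
    by (intro nn_integral_monotone_convergence_SUP)
       (auto simp: incseq_def le_fun_def intro!: ennreal_leI sum_mono2)
  also have "\<dots> \<le> ennreal (of_int (int ?k))"
    by (intro SUP_least integral_drift_until_level_le) simp
  finally show ?thesis by simp
qed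

text \<open>Under recurrence the probability \<open>r j\<close> of at least \<open>N\<close> steps
  from 1 to 0 before hitting \<open>Suc j\<close> tends to one. Its Cesaro means do the same, so
  \<open>partial_drift_times_return_prob_le\<close> divided by \<open>m\<close> bounds the mean of
  the first \<open>N\<close> drifts by one; then \<open>N\<close> grows.\<close>

lemma recurrent_imp_drift_le_1:
  assumes "AE V in iid_unif. recurrent_path (stk.pos V)"
  shows "(\<integral>\<^sup>+V. (\<Sum>k. ennreal (drift V 1 k)) \<partial>iid_unif) \<le> 1"
proof -
  have partial: "(\<integral>\<^sup>+V. ennreal (\<Sum>i<N. drift V 1 i) \<partial>iid_unif) \<le> 1" for N
  proof -
    define r where "r j = measure iid_unif {V. N \<le> cross_count (arrow V) j 0}" for j
    have ev [measurable]: "{V. N \<le> cross_count (arrow V) j x} \<in> sets iid_unif" for j x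
    by (rule iid_unif_sets_Collect) measurable
    define d where "d = enn2real (\<integral>\<^sup>+V. ennreal (\<Sum>i<N. drift V 1 i) \<partial>iid_unif)"
    have "(\<integral>\<^sup>+V. ennreal (\<Sum>i<N. drift V 1 i) \<partial>iid_unif) \<le> (\<integral>\<^sup>+V. ennreal (real N) \<partial>(iid_unif :: (int \<times> nat \<Rightarrow> real) measure))"
    proof (intro nn_integral_mono ennreal_leI)
      fix V
      have "(\<Sum>i<N. drift V 1 i) \<le> (\<Sum>i<N. 1)"
        using drift_bounds(2) by (intro sum_mono) (auto intro: less_imp_le)
      then show "(\<Sum>i<N. drift V 1 i) \<le> real N" by simp
    qed
    also have "\<dots> < \<infinity>"
      by (simp add: iid_unif.emeasure_eq_measure)
    finally have d: "(\<integral>\<^sup>+V. ennreal (\<Sum>i<N. drift V 1 i) \<partial>iid_unif) = ennreal d"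
      by (simp add: d_def)
    have "r \<longlonglongrightarrow> 1"
    proof -
      \<comment> \<open>Asking for all \<open>j \<ge> j0\<close> makes the events increase, so their
        measures converge to that of the union, while \<open>B j\<close> bounds \<open>r j\<close>
        from below.\<close>
      define B where "B j0 = {V. \<forall>j\<ge>j0. N \<le> cross_count (arrow V) j 0}" for j0
      have B: "B j0 \<in> sets iid_unif" for j0
      unfolding B_def by (rule iid_unif_sets_Collect) measurable
      have "AE V in iid_unif. V \<in> (\<Union>j0. B j0)"
        using assms AE_right_reaching AE_full_stack
      proof eventually_elim
        case (elim V)
        interpret right_reaching_stack_walk "arrow V" "stk.pos V" by fact
        interpret full_stack_walk "arrow V" "stk.pos V" by fact
        show ?case
          using cross_count_unbounded[of N] full_down elim(1) by (auto simp: recurrent_path_def B_def)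
      qed
      then have "measure iid_unif (\<Union>j0. B j0) = 1"
        using B by (subst iid_unif.prob_eq_1) auto
      moreover have "(\<lambda>j0. measure iid_unif (B j0)) \<longlonglongrightarrow> measure iid_unif (\<Union>j0. B j0)"
        using B by (intro iid_unif.finite_Lim_measure_incseq) (auto simp: incseq_def B_def)
      ultimately have lim: "(\<lambda>j0. measure iid_unif (B j0)) \<longlonglongrightarrow> 1"
        by simp
      have "measure iid_unif (B j) \<le> r j" for j
        unfolding r_def by (intro iid_unif.finite_measure_mono) (auto simp: B_def)
      moreover have "r j \<le> 1" for j
        by (simp add: r_def)
      ultimately show ?thesis
        by (intro tendsto_sandwich[OF _ _ lim tendsto_const]) auto
    qed
    then have "(\<lambda>m. d * ((\<Sum>j<m. r j) / real m)) \<longlonglongrightarrow> d * 1"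
      by (intro tendsto_mult tendsto_const cesaro_mean_tendsto)
    moreover have "(\<lambda>m. (real m + 1) / real m) \<longlonglongrightarrow> 1"
      by real_asymp
    moreover have "d * ((\<Sum>j<m. r j) / real m) \<le> (real m + 1) / real m" for m
    proof -
      have "ennreal (d * (\<Sum>j<m. r j)) \<le> ennreal (real (Suc m))"
        using partial_drift_times_return_prob_le[of N m]
        by (simp add: d r_def[symmetric] ennreal_mult'' sum_nonneg) (simp add: d_def r_def sum_nonneg ennreal_mult'')
      then have "d * (\<Sum>j<m. r j) \<le> real m + 1"
        by (subst (asm) ennreal_le_iff) auto
      then show ?thesis
        by (simp add: divide_right_mono)
    qed
    ultimately have "d * 1 \<le> 1"
      by (intro LIMSEQ_le) auto
    then show ?thesis
      by (simp add: d)
  qed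
  have "(\<integral>\<^sup>+V. (\<Sum>k. ennreal (drift V 1 k)) \<partial>iid_unif) = (\<integral>\<^sup>+V. (SUP N. ennreal (\<Sum>i<N. drift V 1 i)) \<partial>iid_unif)"
    using drift_bounds(1) by (intro nn_integral_cong) (simp add: suminf_eq_SUP sum_ennreal)
  also have "\<dots> = (SUP N. \<integral>\<^sup>+V. ennreal (\<Sum>i<N. drift V 1 i) \<partial>iid_unif)"
    using drift_bounds(1)
    by (intro nn_integral_monotone_convergence_SUP)
       (auto simp: incseq_def le_fun_def intro!: ennreal_leI sum_mono2)
  also have "\<dots> \<le> 1"
    by (intro SUP_least partial)
  finally show ?thesis .
qed

section \<open>Small mean drift forces recurrence\<close>

lemma nn_integral_total_drift:
  assumes "1 \<le> x"
  shows "(\<integral>\<^sup>+V. total_drift V x \<partial>iid_unif) = mean_drift"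
proof -
  have "(\<integral>\<^sup>+V. total_drift (\<lambda>p. V (shift_index (x - 1) p)) 1 \<partial>iid_unif) = mean_drift"
    unfolding mean_drift_def by (rule nn_integral_iid_unif_reindex[OF inj_shift_index]) measurable
  then show ?thesis
    using assms by (simp add: total_drift_def drift_shift)
qed

lemma nn_integral_later_drift:
  assumes "1 \<le> x"
  shows "(\<integral>\<^sup>+V. of_bool (arrow V x 0) * later_drift V x \<partial>iid_unif) = mean_later_drift"
proof -
  have "(\<integral>\<^sup>+V. of_bool (arrow (\<lambda>p. V (shift_index (x - 1) p)) 1 0) * later_drift (\<lambda>p. V (shift_index (x - 1) p)) 1 \<partial>iid_unif) = mean_later_drift"
    unfolding mean_later_drift_def by (rule nn_integral_iid_unif_reindex[OF inj_shift_index]) measurable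
  then show ?thesis
    using assms by (simp add: later_drift_def drift_shift arrow_shift)
qed

lemma measure_cross_count_le_shift:
  assumes "0 \<le> x"
  shows "measure iid_unif {V. \<forall>j. cross_count (arrow V) j x \<le> N} = measure iid_unif {V. \<forall>j. cross_count (arrow V) j 0 \<le> N}"
proof -
  have "measure iid_unif {V. \<forall>j. cross_count (arrow (\<lambda>p. V (shift_index x p))) j 0 \<le> N} =
      measure iid_unif {V. \<forall>j. cross_count (arrow V) j 0 \<le> N}"
    by (rule measure_iid_unif_reindex[OF inj_shift_index]) measurable
  then show ?thesis
    by (simp only: cross_count_arrow_shift[OF assms])
qed

lemma nn_integral_escape:
  assumes "0 \<le> x"
  shows "(\<integral>\<^sup>+V. of_bool (\<forall>j. cross_count (arrow V) j x = 0) \<partial>iid_unif) = ennreal escape_prob"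
  using measure_cross_count_le_shift[OF assms, of 0]
  by (subst nn_integral_of_bool) (simp_all add: escape_prob_def)

text \<open>Integration of \<open>excursion_drift_plus_unused_le\<close>. Reaching
  \<open>Suc m\<close>, the stack at \<open>Suc m\<close> and the escape to its right depend on
  disjoint sets of sites, so the expectations factorise.\<close>

lemma nn_integral_excursion_drift_le:
  "(\<integral>\<^sup>+V. ennreal (excursion_drift k V n (int (Suc m))) \<partial>iid_unif) +
     ennreal (reach_prob m) * (mean_later_drift * ennreal escape_prob) \<le> ennreal (reach_prob m) * mean_drift"
proof -
  let ?x = "int (Suc m)"
  let ?B = "\<lambda>V. of_bool (arrow V 0 0 \<and> cross_count (arrow V) m 0 = 0) :: ennreal"
  let ?R = "\<lambda>V. of_bool (arrow V ?x 0) * later_drift V ?x"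
  let ?E = "\<lambda>V. of_bool (\<forall>j. cross_count (arrow V) j ?x = 0) :: ennreal"
  have Bcong: "?B V = ?B W" if "\<And>p. p \<in> {..int m} \<times> UNIV \<Longrightarrow> V p = W p" for V W
  proof -
    have "arrow V 0 = arrow W 0"
      using that by (intro arrow_cong) auto
    moreover have "cross_count (arrow V) m 0 = cross_count (arrow W) m 0"
      using that by (intro cross_count_arrow_cong) auto
    ultimately show ?thesis by simp
  qed
  have Rcong: "?R V = ?R W" if "\<And>p. p \<in> {?x} \<times> UNIV \<Longrightarrow> V p = W p" for V W
  proof -
    have "arrow V ?x = arrow W ?x" "later_drift V ?x = later_drift W ?x"
      using that by (intro arrow_cong later_drift_cong; auto)+
    then show ?thesis by simp
  qed
  have Econg: "?E V = ?E W" if "\<And>p. p \<in> {?x<..} \<times> UNIV \<Longrightarrow> V p = W p" for V W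
  proof -
    have "cross_count (arrow V) j ?x = cross_count (arrow W) j ?x" for j
      using that by (intro cross_count_arrow_cong) auto
    then show ?thesis by simp
  qed
  have B: "(\<integral>\<^sup>+V. ?B V \<partial>iid_unif) = ennreal (reach_prob m)"
    unfolding reach_prob_def by (rule nn_integral_of_bool) measurable
  have RE: "(\<integral>\<^sup>+V. ?R V * ?E V \<partial>iid_unif) = mean_later_drift * ennreal escape_prob"
  proof -
    have "(\<integral>\<^sup>+V. ?R V * ?E V \<partial>iid_unif) = (\<integral>\<^sup>+V. ?R V \<partial>iid_unif) * (\<integral>\<^sup>+V. ?E V \<partial>iid_unif)"
    proof (rule nn_integral_iid_unif_indep[where J = "{?x} \<times> UNIV" and K = "{?x<..} \<times> UNIV"])
      show "?R \<in> borel_measurable iid_unif" "?E \<in> borel_measurable iid_unif"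
        by measurable
      show "?R V = ?R W" if "\<And>p. p \<in> {?x} \<times> UNIV \<Longrightarrow> V p = W p" for V W
        by (rule Rcong[OF that])
      show "?E V = ?E W" if "\<And>p. p \<in> {?x<..} \<times> UNIV \<Longrightarrow> V p = W p" for V W
        by (rule Econg[OF that])
    qed auto
    then show ?thesis
      using nn_integral_later_drift[of ?x] nn_integral_escape[of ?x] by simp
  qed
  have "(\<integral>\<^sup>+V. ?B V * (?R V * ?E V) \<partial>iid_unif) = (\<integral>\<^sup>+V. ?B V \<partial>iid_unif) * (\<integral>\<^sup>+V. ?R V * ?E V \<partial>iid_unif)"
  proof (rule nn_integral_iid_unif_indep[where J = "{..int m} \<times> UNIV" and K = "{?x..} \<times> UNIV"])
    show "?B \<in> borel_measurable iid_unif" "(\<lambda>V. ?R V * ?E V) \<in> borel_measurable iid_unif"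
      by measurable
    show "?B V = ?B W" if "\<And>p. p \<in> {..int m} \<times> UNIV \<Longrightarrow> V p = W p" for V W
      by (rule Bcong[OF that])
    show "?R V * ?E V = ?R W * ?E W" if "\<And>p. p \<in> {?x..} \<times> UNIV \<Longrightarrow> V p = W p" for V W
      using Rcong[of V W] Econg[of V W] that by auto
  qed auto
  then have lhs: "(\<integral>\<^sup>+V. ?B V * (?R V * ?E V) \<partial>iid_unif) = ennreal (reach_prob m) * (mean_later_drift * ennreal escape_prob)"
    by (simp only: B RE)
  have "(\<integral>\<^sup>+V. ?B V * total_drift V ?x \<partial>iid_unif) = (\<integral>\<^sup>+V. ?B V \<partial>iid_unif) * (\<integral>\<^sup>+V. total_drift V ?x \<partial>iid_unif)"
  proof (rule nn_integral_iid_unif_indep[where J = "{..int m} \<times> UNIV" and K = "{?x} \<times> UNIV"])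
    show "?B \<in> borel_measurable iid_unif" "(\<lambda>V. total_drift V ?x) \<in> borel_measurable iid_unif"
      by measurable
    show "?B V = ?B W" if "\<And>p. p \<in> {..int m} \<times> UNIV \<Longrightarrow> V p = W p" for V W
      by (rule Bcong[OF that])
    show "total_drift V ?x = total_drift W ?x" if "\<And>p. p \<in> {?x} \<times> UNIV \<Longrightarrow> V p = W p" for V W
      using that by (intro total_drift_cong) auto
  qed auto
  then have rhs: "(\<integral>\<^sup>+V. ?B V * total_drift V ?x \<partial>iid_unif) = ennreal (reach_prob m) * mean_drift"
    using nn_integral_total_drift[of ?x] by (simp only: B)
  have "(\<integral>\<^sup>+V. ennreal (excursion_drift k V n ?x) \<partial>iid_unif) + (\<integral>\<^sup>+V. ?B V * (?R V * ?E V) \<partial>iid_unif) =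
      (\<integral>\<^sup>+V. ennreal (excursion_drift k V n ?x) + ?B V * (?R V * ?E V) \<partial>iid_unif)"
    by (rule nn_integral_add[symmetric]) measurable
  also have "\<dots> \<le> (\<integral>\<^sup>+V. ?B V * total_drift V ?x \<partial>iid_unif)"
    by (rule nn_integral_mono_AE, use AE_right_reaching in eventually_elim) (rule excursion_drift_plus_unused_le)
  finally show ?thesis
    by (simp only: lhs rhs)
qed

lemma integrable_excursion_drift: "integrable iid_unif (\<lambda>V. excursion_drift k V n x)"
  unfolding excursion_drift_def stk.pos_def
  by (intro Bochner_Integration.integrable_sum
      stk.integrable_path[of "\<lambda>xs. of_bool (excursion_alive k xs \<and> last xs = x) * (2 * up_prob xs - 1)"])

lemma integral_excursion_drift_le:
  assumes "mean_drift \<le> 1"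
  shows "(\<integral>V. excursion_drift k V n (int (Suc m)) \<partial>iid_unif) \<le>
     reach_prob m * (enn2real mean_drift - enn2real mean_later_drift * escape_prob)"
proof -
  define g h where "g = enn2real mean_drift" and "h = enn2real mean_later_drift"
  have "mean_drift < top" "mean_later_drift < top"
    using le_less_trans[OF assms] le_less_trans[OF order_trans[OF mean_later_drift_le assms]] by auto
  then have g: "mean_drift = ennreal g" "0 \<le> g" and h: "mean_later_drift = ennreal h" "0 \<le> h"
    by (simp_all add: g_def h_def)
  have b: "0 \<le> reach_prob m" "0 \<le> escape_prob"
    by (simp_all add: reach_prob_def escape_prob_def)
  let ?w = "\<integral>V. excursion_drift k V n (int (Suc m)) \<partial>iid_unif"
  have "(\<integral>\<^sup>+V. ennreal (excursion_drift k V n (int (Suc m))) \<partial>iid_unif) = ennreal ?w"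
    using excursion_drift_nonneg by (intro nn_integral_eq_integral integrable_excursion_drift AE_I2)
  moreover have "0 \<le> ?w"
    by (intro integral_nonneg_AE AE_I2 excursion_drift_nonneg)
  ultimately have "ennreal (?w + reach_prob m * (h * escape_prob)) \<le> ennreal (reach_prob m * g)"
    using nn_integral_excursion_drift_le[of k n m] b g(2) h(2)
    by (simp add: g(1) h(1) flip: ennreal_mult ennreal_plus)
  then have "?w + reach_prob m * (h * escape_prob) \<le> reach_prob m * g"
    using b g by (subst (asm) ennreal_le_iff) auto
  then show ?thesis
    by (simp add: g_def h_def algebra_simps)
qed

text \<open>The martingale identity equates the mean gain of an excursion with the mean drift it
  consumes at the sites \<open>1, ..., j\<close>. The gain is bounded below by
  \<open>excursion_gain_lower\<close>, each site by \<open>integral_excursion_drift_le\<close>. The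
  identity is used at fixed times \<open>n\<close>, which then tend to infinity.\<close>

lemma reach_prob_recursion:
  assumes "mean_drift \<le> 1"
  shows "real (Suc j) * reach_prob j \<le> 1 +
     (enn2real mean_drift - enn2real mean_later_drift * escape_prob) * (\<Sum>m<j. reach_prob m)"
proof -
  let ?c = "enn2real mean_drift - enn2real mean_later_drift * escape_prob"
  let ?k = "Suc j"
  define Q where "Q n = {V. arrow V 0 0 \<and> cross_count (arrow V) j 0 = 0 \<and> (\<exists>i\<le>n. stk.pos V i = int ?k)}" for n
  have Q [measurable]: "Q n \<in> sets iid_unif" for n
    unfolding Q_def by (rule iid_unif_sets_Collect) measurable
  have A [measurable]: "{V. arrow V 0 0} \<in> sets iid_unif"
    by (rule iid_unif_sets_Collect) measurable
  have k1: "1 \<le> ?k" by simp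
  have bound: "real ?k * measure iid_unif (Q n) \<le> 1 + ?c * (\<Sum>m<j. reach_prob m)" for n
  proof -
    have int_gain: "integrable iid_unif (\<lambda>V. excursion_gain (int ?k) V n)"
    proof -
      define F :: "int list \<Rightarrow> real" where "F xs = (\<Sum>i<n. of_bool (excursion_alive (int ?k) (take (Suc i) xs)) *
          of_int (xs ! Suc i - xs ! i))" for xs
      have "excursion_gain (int ?k) V n = F (stk.path V n)" for V
        unfolding excursion_gain_def F_def by (intro sum.cong) (auto simp: stk.path_nth stk.path_prefix)
      then show ?thesis
        using stk.integrable_path[of F n] by simp
    qed
    \<comment> \<open>The constant 1 bounds the probability of a first up arrow, which enters
      \<open>excursion_gain_lower\<close> as the loss of a failed excursion.\<close>
    have "real ?k * measure iid_unif (Q n) - 1 \<le> real ?k * measure iid_unif (Q n) - measure iid_unif {V. arrow V 0 0}"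
      by simp
    also have "\<dots> = (\<integral>V. real ?k * indicator (Q n) V - indicator {V. arrow V 0 0} V \<partial>iid_unif)"
      by (subst Bochner_Integration.integral_diff) (auto simp: iid_unif.emeasure_eq_measure)
    also have "\<dots> \<le> (\<integral>V. excursion_gain (int ?k) V n \<partial>iid_unif)"
    proof (rule integral_mono)
      fix V
      show "real ?k * indicator (Q n) V - indicator {V. arrow V 0 0} V \<le> excursion_gain (int ?k) V n"
        using excursion_gain_lower[of j V n] by (simp add: Q_def indicator_def of_bool_def)
    qed (use int_gain in \<open>auto simp: iid_unif.emeasure_eq_measure simp del: of_nat_Suc\<close>)
    also have "\<dots> = (\<integral>V. (\<Sum>x=1..<?k. excursion_drift (int ?k) V n (int x)) \<partial>iid_unif)"
      unfolding excursion_gain_def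
      using stk.integral_stopped_walk[of "\<lambda>xs. of_bool (excursion_alive (int ?k) xs)" n]
      by (simp only: sum_excursion_drift[OF k1])
    also have "\<dots> = (\<Sum>x=1..<?k. \<integral>V. excursion_drift (int ?k) V n (int x) \<partial>iid_unif)"
      by (intro Bochner_Integration.integral_sum integrable_excursion_drift)
    also have "\<dots> = (\<Sum>m<j. \<integral>V. excursion_drift (int ?k) V n (int (Suc m)) \<partial>iid_unif)"
      by (rule sum.reindex_bij_witness[of _ Suc "\<lambda>x. x - 1"]) auto
    also have "\<dots> \<le> (\<Sum>m<j. reach_prob m * ?c)"
      by (intro sum_mono integral_excursion_drift_le assms)
    finally show ?thesis
      by (simp add: sum_distrib_right[symmetric] mult.commute)
  qed
  have "measure iid_unif (\<Union>n. Q n) = reach_prob j"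
    unfolding reach_prob_def
  proof (rule measure_eq_AE)
    show "AE V in iid_unif. V \<in> (\<Union>n. Q n) \<longleftrightarrow> V \<in> {V. arrow V 0 0 \<and> cross_count (arrow V) j 0 = 0}"
      using AE_right_reaching
    proof eventually_elim
      case (elim V)
      interpret right_reaching_stack_walk "arrow V" "stk.pos V" by fact
      obtain i where "stk.pos V i = int ?k"
        using hits[of "int ?k"] by auto
      then show ?case by (auto simp: Q_def)
    qed
    show "{V. arrow V 0 0 \<and> cross_count (arrow V) j 0 = 0} \<in> sets iid_unif"
      by (rule iid_unif_sets_Collect) measurable
  qed auto
  moreover have "(\<lambda>n. measure iid_unif (Q n)) \<longlonglongrightarrow> measure iid_unif (\<Union>n. Q n)"
    using Q by (intro iid_unif.finite_Lim_measure_incseq) (auto simp: incseq_def Q_def intro: order_trans)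
  ultimately have "(\<lambda>n. real ?k * measure iid_unif (Q n)) \<longlonglongrightarrow> real ?k * reach_prob j"
    by (intro tendsto_mult tendsto_const) simp
  then show ?thesis
    by (rule LIMSEQ_le_const2) (use bound in blast)
qed

text \<open>With positive probability, by transience and a shift, at most \<open>N\<close> steps
  lead from 2 to 1. Independently of this, the first \<open>N + 1\<close> arrows at site 1 may all
  be up, and together the two events prevent every step from 1 to 0.\<close>

lemma escape_prob_pos:
  assumes "\<not> (AE V in iid_unif. recurrent_path (stk.pos V))"
  shows "0 < escape_prob"
proof -
  obtain N where N: "0 < measure iid_unif {V. \<forall>j. cross_count (arrow V) j 0 \<le> N}"
    using bounded_cross_count_if_transient[OF assms] by blast
  let ?U = "\<lambda>V :: int \<times> nat \<Rightarrow> real. \<forall>i<Suc N. (V (1, i) < 1/2) = True"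
  let ?E = "\<lambda>V. \<forall>j. cross_count (arrow V) j 1 \<le> N"
  have "(\<integral>\<^sup>+V. of_bool (?U V) * of_bool (?E V) \<partial>iid_unif) =
      (\<integral>\<^sup>+V. of_bool (?U V) \<partial>iid_unif) * (\<integral>\<^sup>+V. of_bool (?E V) \<partial>iid_unif)"
  proof (rule nn_integral_iid_unif_indep[where J = "{1} \<times> UNIV" and K = "{1<..} \<times> UNIV"])
    show "of_bool (?E V) = of_bool (?E W)" if "\<And>p. p \<in> {1<..} \<times> UNIV \<Longrightarrow> V p = W p" for V W
    proof -
      have "cross_count (arrow V) j 1 = cross_count (arrow W) j 1" for j
        using that by (intro cross_count_arrow_cong) auto
      then show ?thesis by simp
    qed
  qed auto
  also have "(\<integral>\<^sup>+V. of_bool (?U V) \<partial>iid_unif) = ennreal ((1/2) ^ Suc N)"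
    using measure_iid_unif_box[of "\<lambda>i. (1::int, i)" "Suc N" "\<lambda>_. 1/2" "\<lambda>_. True"]
    by (subst nn_integral_of_bool) (simp_all add: inj_on_def)
  also have "(\<integral>\<^sup>+V. of_bool (?E V) \<partial>iid_unif) = ennreal (measure iid_unif {V. \<forall>j. cross_count (arrow V) j 0 \<le> N})"
    using measure_cross_count_le_shift[of 1 N] by (subst nn_integral_of_bool) simp_all
  finally have "ennreal ((1/2) ^ Suc N) * ennreal (measure iid_unif {V. \<forall>j. cross_count (arrow V) j 0 \<le> N}) =
      (\<integral>\<^sup>+V. of_bool (?U V) * of_bool (?E V) \<partial>iid_unif)" ..
  also have "\<dots> \<le> (\<integral>\<^sup>+V. of_bool (\<forall>j. cross_count (arrow V) j 0 = 0) \<partial>iid_unif)"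
  proof (rule nn_integral_mono)
    fix V
    have "cross_count (arrow V) j 0 = 0" if "?U V" "?E V" for j
    proof (cases j)
      case (Suc i)
      have "arrow V 1 i'" if "i' \<le> cross_count (arrow V) i 1" for i'
      proof -
        have "i' < Suc N" using that \<open>?E V\<close> by (metis le_trans less_Suc_eq_le)
        then show ?thesis
          using \<open>?U V\<close> f_ge_half[OF stack_alpha_in_unit[of V 1 i']] by (force simp: arrow_def)
      qed
      then show ?thesis
        by (simp add: Suc downs_before_up_eq_0)
    qed simp
    then show "of_bool (?U V) * of_bool (?E V) \<le> (of_bool (\<forall>j. cross_count (arrow V) j 0 = 0) :: ennreal)"
      by auto
  qed
  also have "\<dots> = ennreal escape_prob"
    by (rule nn_integral_escape) simp
  finally have "ennreal ((1/2) ^ Suc N) * ennreal (measure iid_unif {V. \<forall>j. cross_count (arrow V) j 0 \<le> N}) \<le> ennreal escape_prob" .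
  moreover have "0 < ennreal ((1/2) ^ Suc N) * ennreal (measure iid_unif {V. \<forall>j. cross_count (arrow V) j 0 \<le> N})"
    using N by (simp add: ennreal_zero_less_mult_iff)
  ultimately have "0 < ennreal escape_prob"
    by (rule less_le_trans[rotated])
  then show ?thesis by simp
qed

text \<open>If recurrence failed, \<open>reach_prob\<close> would decrease to some
  \<open>L > 0\<close>. Dividing the recursion by \<open>j\<close> and passing to the limit gives
  \<open>L \<le> ?c * L\<close>, impossible for \<open>?c < 1\<close>.\<close>

lemma drift_le_1_imp_recurrent:
  assumes "mean_drift \<le> 1"
  shows "AE V in iid_unif. recurrent_path (stk.pos V)"
proof (rule ccontr)
  assume "\<not> ?thesis"
  then have esc: "0 < escape_prob"
    by (rule escape_prob_pos)
  let ?c = "enn2real mean_drift - enn2real mean_later_drift * escape_prob"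
  \<comment> \<open>\<open>enn2real\<close> maps an infinite mean to 0, so finiteness is recorded
    before \<open>enn2real mean_later_drift\<close> is claimed to be positive.\<close>
  have fin: "mean_drift < top" "mean_later_drift < top"
    using le_less_trans[OF assms] le_less_trans[OF order_trans[OF mean_later_drift_le assms]] by auto
  have g_le: "enn2real mean_drift \<le> 1"
    using assms by (metis enn2real_1 enn2real_mono ennreal_one_less_top)
  \<comment> \<open>Either both means vanish, or \<open>mean_later_drift\<close> and
    \<open>escape_prob\<close> are positive and push \<open>?c\<close> strictly below the mean
    drift.\<close>
  have c: "?c < 1"
  proof (cases "mean_drift = 0")
    case True
    then have "mean_later_drift = 0"
      using mean_later_drift_le by simp
    with True show ?thesis by simp
  next
    case False
    then have "0 < enn2real mean_later_drift"
      using mean_later_drift_pos fin by (simp add: enn2real_positive_iff zero_less_iff_neq_zero)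
    then have "0 < enn2real mean_later_drift * escape_prob"
      using esc by simp
    with g_le show ?thesis by linarith
  qed
  have "0 \<le> reach_prob j" for j
    by (simp add: reach_prob_def)
  then obtain L where L: "reach_prob \<longlonglongrightarrow> L"
    using decseq_convergent[OF reach_prob_decseq, of 0] by blast
  have "escape_prob / 2 \<le> L"
    using escape_prob_le_reach_prob by (intro LIMSEQ_le_const[OF L]) auto
  then have "0 < L" using esc by simp
  have "(\<lambda>j. 1 / real j + ?c * ((\<Sum>m<j. reach_prob m) / real j)) \<longlonglongrightarrow> 0 + ?c * L"
    by (intro tendsto_add tendsto_mult tendsto_const cesaro_mean_tendsto L lim_1_over_n)
  moreover have "reach_prob j \<le> 1 / real j + ?c * ((\<Sum>m<j. reach_prob m) / real j)" if "1 \<le> j" for j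
  proof -
    have "0 \<le> reach_prob j" by (simp add: reach_prob_def)
    then have "real j * reach_prob j \<le> 1 + ?c * (\<Sum>m<j. reach_prob m)"
      using reach_prob_recursion[OF assms, of j] by (simp add: algebra_simps)
    then have "reach_prob j \<le> (1 + ?c * (\<Sum>m<j. reach_prob m)) / real j"
      using that by (simp add: field_simps)
    then show ?thesis by (simp add: add_divide_distrib)
  qed
  ultimately have "L \<le> 0 + ?c * L"
    using L by (intro LIMSEQ_le) auto
  then have "0 \<le> (?c - 1) * L"
    by (simp add: algebra_simps)
  with c \<open>0 < L\<close> show False
    by (simp add: zero_le_mult_iff)
qed

text \<open>Reading off the stack of site 1 is an injective reindexing of coordinates, which
  preserves the product law, and that stack runs the urn of the theorem.\<close>

lemma mean_drift_eq_urn: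
  "mean_drift = (\<integral>\<^sup>+U. (\<Sum>k. ennreal (2 * f (urn_alpha f (a0 1) (l0 1) U k) - 1)) \<partial>unif_seq)"
proof -
  \<comment> \<open>Feeding one sequence to all stacks exhibits the urn series as a measurable
    function of that sequence.\<close>
  have "(\<lambda>U p. U (snd p)) \<in> measurable iid_unif (iid_unif :: (int \<times> nat \<Rightarrow> real) measure)"
    by (rule measurable_into_iid_unif) simp
  from measurable_compose[OF this total_drift_measurable[of 1]]
  have "(\<lambda>U. \<Sum>k. ennreal (2 * f (urn_alpha f (a0 1) (l0 1) U k) - 1)) \<in> borel_measurable iid_unif"
    by (simp add: total_drift_def drift_def stack_alpha_def)
  from nn_integral_iid_unif_reindex[OF _ this, of "\<lambda>i. (1::int, i)"]
  show ?thesis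
    by (simp add: mean_drift_def total_drift_def drift_def stack_alpha_def unif_seq_eq_iid_unif inj_def)
qed

end

theorem theorem1:
  fixes f :: "real \<Rightarrow> real" and a0 l0 :: "int \<Rightarrow> real"
  assumes "C3_on_unit f"
    and "\<forall>x\<in>{0..1}. 0 < f x \<and> f x < 1"
    and "isolated_fixed_points f"
    and "\<forall>x\<in>{0..1}. f x \<ge> 1/2"
    and "\<forall>x. 0 \<le> a0 x \<and> a0 x \<le> 1 \<and> 0 < l0 x"
    and "\<forall>x\<ge>1. a0 x = a0 1 \<and> l0 x = l0 1"
  shows "(AE U in unif_seq. recurrent_path (grrw f a0 l0 U))
     \<longleftrightarrow> (\<integral>\<^sup>+ U. (\<Sum>k. ennreal (2 * f (urn_alpha f (a0 1) (l0 1) U k) - 1)) \<partial>unif_seq) \<le> 1"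
proof -
  obtain f1 where "\<forall>x\<in>{0..1}. (f has_real_derivative f1 x) (at x within {0..1})"
    using assms(1) unfolding C3_on_unit_def by blast
  then have "continuous_on {0..1} f"
    by (intro DERIV_continuous_on) auto
  moreover have "1/2 \<le> f y" "f y < 1" if "y \<in> {0..1}" for y
    using assms(2,4) that by auto
  ultimately interpret grrw_homogeneous f a0 l0
    using assms(5,6) by unfold_locales blast+
  show ?thesis
    unfolding AE_recurrent_grrw_iff mean_drift_eq_urn[symmetric]
    using recurrent_imp_drift_le_1 drift_le_1_imp_recurrent
    by (auto simp: mean_drift_def total_drift_def)
qed

end
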